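(* Let $Y$ be a based space satisfying the standing assumptions in the context. For $N\geq 1$ let $\Lambda^N(Y)$ denote the $N$-fold iterated free loop space of $Y$. Then, for each $n\geq 1$, $$G_n\big(\Lambda^N(Y)\big)\cong\bigoplus_{j=0}^{N}\binom{N}{j}\,G_{n+j}(Y).$$
   Context: Standing assumptions: $Y$ is a based space that is connected, locally compact, Hausdorff and well-pointed (no finiteness or simple connectivity is assumed). Mapping spaces consist of unbased maps and carry the compact-open topology; $\mathrm{map}(X,Y;0)$ denotes the path component of the null (constant) map, based at the constant map at the basepoint of $Y$. $\Lambda Y=\mathrm{map}(S^1,Y;0)$ is the null component of the free loop space of $Y$; $\Lambda^1(Y)=\Lambda Y$ and $\Lambda^N(Y)=\Lambda(\Lambda^{N-1}(Y))$ for $N\ge2$. For a based space $Z$, $\mathrm{aut}_1 Z$ denotes the path component of the identity map $1_Z$ in the space of unbased self-maps of $Z$, based at $1_Z$, and $\omega\colon \mathrm{aut}_1 Z\to Z$ is evaluation at the basepoint of $Z$. The $n$th Gottlieb group $G_n(Z)$ ($n\ge1$) is the image of $\omega_\#\colon\pi_n(\mathrm{aut}_1 Z)\to\pi_n(Z)$; it is abelian. For an integer $k\ge1$ and an abelian group $G$, $kG$ denotes the direct sum of $k$ copies of $G$.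
   Formalization: "Connected" is taken to mean path connected; for spaces that are only topologically connected the claim fails, e.g. for a circle with a ray spiralling onto a second, disjoint circle, where G_1(ΛY) is infinite cyclic but G_1(Y) and G_2(Y) vanish. *)

theory Defs
  imports "HOL-Analysis.Analysis" "HOL-Algebra.Product_Groups"
begin

section \<open>Mapping spaces\<close>

text \<open>The compact-open topology. A map out of \<open>X\<close> is represented by the function that is
  \<^const>\<open>undefined\<close> off \<open>topspace X\<close>, so that distinct points are distinct maps. No base points
  are involved.\<close>

definition mapping_set :: "'a topology \<Rightarrow> 'b topology \<Rightarrow> ('a \<Rightarrow> 'b) set" where
  "mapping_set X Y = {f \<in> extensional (topspace X). continuous_map X Y f}"

definition mapping_space :: "'a topology \<Rightarrow> 'b topology \<Rightarrow> ('a \<Rightarrow> 'b) topology" where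
  "mapping_space X Y =
     topology_generated_by
       {{f \<in> mapping_set X Y. f ` K \<subseteq> U} | K U. compactin X K \<and> openin Y U}"

definition mapping_component ::
    "'a topology \<Rightarrow> 'b topology \<Rightarrow> ('a \<Rightarrow> 'b) \<Rightarrow> ('a \<Rightarrow> 'b) topology" where
  "mapping_component X Y f =
     subtopology (mapping_space X Y) (Collect (path_component_of (mapping_space X Y) f))"

lemma topspace_mapping_space [simp]: "topspace (mapping_space X Y) = mapping_set X Y"
proof -
  have "mapping_set X Y = {f \<in> mapping_set X Y. f ` {} \<subseteq> topspace Y}"
    by auto
  then have "mapping_set X Y \<in>
      {{f \<in> mapping_set X Y. f ` K \<subseteq> U} | K U. compactin X K \<and> openin Y U}"
    using compactin_empty openin_topspace by blast
  then show ?thesis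
    unfolding mapping_space_def topology_generated_by_topspace by blast
qed


section \<open>Iterated free loop spaces\<close>

abbreviation circle :: "complex topology" where
  "circle \<equiv> top_of_set (sphere 0 1)"

definition const_loop :: "'a \<Rightarrow> complex \<Rightarrow> 'a" where
  "const_loop y = (\<lambda>z\<in>topspace circle. y)"

definition free_loop_space :: "'a topology \<Rightarrow> 'a \<Rightarrow> (complex \<Rightarrow> 'a) topology" where
  "free_loop_space Y y = mapping_component circle Y (const_loop y)"

text \<open>Forming the free loop space changes the type of points, so the \<open>N\<close>-fold iterate, for
  variable \<open>N\<close>, is built on a single type into which points of \<open>Y\<close> and loops of iterated loops
  both embed; the topologies are transported along the two embeddings. The \<open>0\<close>-fold iterate is
  \<open>Y\<close> itself.\<close>

datatype 'a iterated_loop =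
  Point (the_point: 'a) | Loop (the_loop: "complex \<Rightarrow> 'a iterated_loop")

primrec iterated_const_loop :: "nat \<Rightarrow> 'a \<Rightarrow> 'a iterated_loop" where
  "iterated_const_loop 0 y = Point y"
| "iterated_const_loop (Suc N) y = Loop (const_loop (iterated_const_loop N y))"

primrec iterated_free_loop_space ::
    "nat \<Rightarrow> 'a topology \<Rightarrow> 'a \<Rightarrow> 'a iterated_loop topology" where
  "iterated_free_loop_space 0 Y y = pullback_topology (range Point) the_point Y"
| "iterated_free_loop_space (Suc N) Y y =
     pullback_topology (range Loop) the_loop
       (free_loop_space (iterated_free_loop_space N Y y) (iterated_const_loop N y))"

lemma homeomorphic_pullback_topology:
  assumes "\<And>x. d (c x) = x"
  shows "homeomorphic_maps T (pullback_topology (range c) d T) c d"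
proof -
  have "continuous_map T (pullback_topology (range c) d T) c"
    by (rule continuous_map_pullback') (auto simp: assms comp_def)
  moreover have "continuous_map (pullback_topology (range c) d T) T d"
    using continuous_map_pullback[OF continuous_map_id, of "range c" d T] by simp
  ultimately show ?thesis
    by (auto simp: homeomorphic_maps_def assms topspace_pullback_topology)
qed

lemma iterated_free_loop_space_0_homeomorphic:
  "homeomorphic_maps Y (iterated_free_loop_space 0 Y y) Point the_point"
  by (simp add: homeomorphic_pullback_topology)

lemma iterated_free_loop_space_Suc_homeomorphic:
  "homeomorphic_maps
     (free_loop_space (iterated_free_loop_space N Y y) (iterated_const_loop N y))
     (iterated_free_loop_space (Suc N) Y y) Loop the_loop"
  by (simp add: homeomorphic_pullback_topology)


section \<open>Well-pointed spaces\<close>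

abbreviation unit_interval :: "real topology" where
  "unit_interval \<equiv> top_of_set {0..1}"

definition homotopy_extension_property ::
    "'a topology \<Rightarrow> 'a set \<Rightarrow> 'b topology \<Rightarrow> bool" where
  "homotopy_extension_property X A Z \<longleftrightarrow>
     (\<forall>f h. continuous_map X Z f \<and>
            continuous_map (prod_topology (subtopology X A) unit_interval) Z h \<and>
            (\<forall>a\<in>A. h (a, 0) = f a) \<longrightarrow>
        (\<exists>H. continuous_map (prod_topology X unit_interval) Z H \<and>
             (\<forall>x\<in>topspace X. H (x, 0) = f x) \<and>
             (\<forall>a\<in>A. \<forall>t\<in>{0..1}. H (a, t) = h (a, t))))"

text \<open>The target spaces cannot range over all types inside a definition. The type
  \<open>'a \<times> real\<close> suffices, because it carries the mapping cylinder of the inclusion of \<open>A\<close>,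
  which is the universal target; see the lemma below.\<close>

definition cofibration :: "'a topology \<Rightarrow> 'a set \<Rightarrow> bool" where
  "cofibration X A \<longleftrightarrow>
     A \<subseteq> topspace X \<and> (\<forall>Z :: ('a \<times> real) topology. homotopy_extension_property X A Z)"

definition well_pointed :: "'a topology \<Rightarrow> 'a \<Rightarrow> bool" where
  "well_pointed X x \<longleftrightarrow> cofibration X {x}"

lemma cofibration_imp_homotopy_extension_property:
  fixes X :: "'a topology" and Z :: "'b topology"
  assumes cof: "cofibration X A"
  shows "homotopy_extension_property X A Z"
  unfolding homotopy_extension_property_def
proof (intro allI impI, elim conjE)
  fix f h
  assume f: "continuous_map X Z f"
    and h: "continuous_map (prod_topology (subtopology X A) unit_interval) Z h"
    and fh: "\<forall>a\<in>A. h (a, 0) = f a"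
  have A: "A \<subseteq> topspace X"
    using cof by (simp add: cofibration_def)
  define P where "P = prod_topology (subtopology X A) unit_interval"
  have topP: "topspace P = A \<times> {0..1}"
    using A by (auto simp: P_def)
  define C where "C = topspace X \<times> {0::real} \<union> A \<times> {0..1}"
  define opn where "opn = (\<lambda>U. U \<subseteq> C \<and> openin X {x \<in> topspace X. (x, 0) \<in> U}
      \<and> openin P {p \<in> topspace P. p \<in> U})"
  have ist: "istopology opn"
    unfolding istopology_def
  proof (intro conjI allI impI)
    fix S T assume "opn S" "opn T"
    moreover have "{x \<in> topspace X. (x, 0) \<in> S \<inter> T} =
        {x \<in> topspace X. (x, 0) \<in> S} \<inter> {x \<in> topspace X. (x, 0) \<in> T}"
      "{p \<in> topspace P. p \<in> S \<inter> T} = {p \<in> topspace P. p \<in> S} \<inter> {p \<in> topspace P. p \<in> T}"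
      by auto
    ultimately show "opn (S \<inter> T)"
      by (auto simp: opn_def intro: openin_Int)
  next
    fix \<K> assume "\<forall>K\<in>\<K>. opn K"
    moreover have "{x \<in> topspace X. (x, 0) \<in> \<Union>\<K>} = (\<Union>K\<in>\<K>. {x \<in> topspace X. (x, 0) \<in> K})"
      "{p \<in> topspace P. p \<in> \<Union>\<K>} = (\<Union>K\<in>\<K>. {p \<in> topspace P. p \<in> K})"
      by auto
    ultimately show "opn (\<Union>\<K>)"
      unfolding opn_def by (auto simp del: mem_Collect_eq)
  qed
  define M where "M = topology opn"
  have opM: "openin M U = opn U" for U
    using ist by (simp add: M_def)
  have "{x \<in> topspace X. (x, 0) \<in> C} = topspace X" "{p \<in> topspace P. p \<in> C} = topspace P"
    by (auto simp: C_def topP)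
  then have "opn C"
    by (simp add: opn_def)
  then have topM: "topspace M = C"
    by (metis opM opn_def openin_subset openin_topspace subset_antisym)
  have "continuous_map X M (\<lambda>x. (x, 0))"
    by (auto simp: continuous_map_def topM C_def opM opn_def)
  moreover have "continuous_map P M id"
    by (auto simp: continuous_map_def topM C_def opM opn_def topP)
  moreover have "homotopy_extension_property X A M"
    using cof by (simp add: cofibration_def)
  ultimately obtain H where H: "continuous_map (prod_topology X unit_interval) M H"
    and H0: "\<And>x. x \<in> topspace X \<Longrightarrow> H (x, 0) = (x, 0)"
    and HA: "\<And>a t. a \<in> A \<Longrightarrow> t \<in> {0..1} \<Longrightarrow> H (a, t) = (a, t)"
    unfolding homotopy_extension_property_def P_def
    by (metis (no_types, lifting) id_apply)
  define g where "g = (\<lambda>(x, t). if x \<in> A then h (x, t) else f x)"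
  have g0: "g (x, 0) = f x" for x
    using fh by (simp add: g_def)
  have gA: "g p = h p" if "p \<in> topspace P" for p
    using that by (auto simp: g_def topP)
  have "continuous_map M Z g"
    unfolding continuous_map_def
  proof (intro conjI allI impI)
    show "g \<in> topspace M \<rightarrow> topspace Z"
    proof
      fix p assume "p \<in> topspace M"
      then consider x where "x \<in> topspace X" "p = (x, 0)" | "p \<in> topspace P"
        by (auto simp: topM C_def topP)
      then show "g p \<in> topspace Z"
      proof cases
        case 1
        then show ?thesis
          using f by (simp add: g0 continuous_map_def Pi_iff)
      next
        case 2
        then show ?thesis
          using h unfolding gA[OF 2] P_def continuous_map_def by blast
      qed
    qed
  next
    fix U assume U: "openin Z U"
    have "{x \<in> topspace X. (x, 0) \<in> {p \<in> topspace M. g p \<in> U}} = {x \<in> topspace X. f x \<in> U}"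
      by (auto simp: topM C_def g0)
    moreover have "{p \<in> topspace P. p \<in> {p \<in> topspace M. g p \<in> U}} = {p \<in> topspace P. h p \<in> U}"
      using gA by (auto simp: topM C_def topP)
    ultimately show "openin M {p \<in> topspace M. g p \<in> U}"
      using f h U topM by (auto simp: opM opn_def P_def continuous_map_def)
  qed
  then have "continuous_map (prod_topology X unit_interval) Z (g \<circ> H)"
    using H continuous_map_compose by blast
  moreover have "\<forall>x\<in>topspace X. (g \<circ> H) (x, 0) = f x"
    by (simp add: H0 g0)
  moreover have "\<forall>a\<in>A. \<forall>t\<in>{0..1}. (g \<circ> H) (a, t) = h (a, t)"
    using HA by (simp add: g_def)
  ultimately show "\<exists>H. continuous_map (prod_topology X unit_interval) Z H \<and>
      (\<forall>x\<in>topspace X. H (x, 0) = f x) \<and> (\<forall>a\<in>A. \<forall>t\<in>{0..1}. H (a, t) = h (a, t))"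
    by blast
qed


section \<open>Homotopy groups\<close>

text \<open>Elements are homotopy classes of maps of pairs from the \<open>n\<close>-cube and its boundary to
  \<open>(X, x)\<close>; the product is induced by concatenation in the first coordinate. The definition is
  meant for \<open>n \<ge> 1\<close>.\<close>

definition cube :: "nat \<Rightarrow> (nat \<Rightarrow> real) topology" where
  "cube n = product_topology (\<lambda>_. unit_interval) {..<n}"

definition cube_boundary :: "nat \<Rightarrow> (nat \<Rightarrow> real) set" where
  "cube_boundary n = {p \<in> topspace (cube n). \<exists>i<n. p i = 0 \<or> p i = 1}"

definition spheroid :: "nat \<Rightarrow> 'a topology \<Rightarrow> 'a \<Rightarrow> ((nat \<Rightarrow> real) \<Rightarrow> 'a) \<Rightarrow> bool" where
  "spheroid n X x f \<longleftrightarrow> continuous_map (cube n) X f \<and> (\<forall>p\<in>cube_boundary n. f p = x)"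

definition spheroid_homotopic ::
    "nat \<Rightarrow> 'a topology \<Rightarrow> 'a \<Rightarrow> ((nat \<Rightarrow> real) \<Rightarrow> 'a) \<Rightarrow> ((nat \<Rightarrow> real) \<Rightarrow> 'a) \<Rightarrow> bool" where
  "spheroid_homotopic n X x = homotopic_with (\<lambda>f. \<forall>p\<in>cube_boundary n. f p = x) (cube n) X"

definition spheroid_class ::
    "nat \<Rightarrow> 'a topology \<Rightarrow> 'a \<Rightarrow> ((nat \<Rightarrow> real) \<Rightarrow> 'a) \<Rightarrow> ((nat \<Rightarrow> real) \<Rightarrow> 'a) set" where
  "spheroid_class n X x f = Collect (spheroid_homotopic n X x f)"

definition spheroid_concat ::
    "((nat \<Rightarrow> real) \<Rightarrow> 'a) \<Rightarrow> ((nat \<Rightarrow> real) \<Rightarrow> 'a) \<Rightarrow> (nat \<Rightarrow> real) \<Rightarrow> 'a" where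
  "spheroid_concat f g =
     (\<lambda>p. if p 0 \<le> 1/2 then f (p(0 := 2 * p 0)) else g (p(0 := 2 * p 0 - 1)))"

definition homotopy_group ::
    "nat \<Rightarrow> 'a topology \<Rightarrow> 'a \<Rightarrow> ((nat \<Rightarrow> real) \<Rightarrow> 'a) set monoid" where
  "homotopy_group n X x =
     \<lparr>carrier = spheroid_class n X x ` Collect (spheroid n X x),
      monoid.mult = (\<lambda>A B. \<Union>f\<in>A. \<Union>g\<in>B. spheroid_class n X x (spheroid_concat f g)),
      one = spheroid_class n X x (\<lambda>_. x)\<rparr>"

text \<open>The homomorphism induced by a based map \<open>\<phi>\<close> into \<open>(Y, y)\<close>.\<close>

definition homotopy_induced ::
    "nat \<Rightarrow> 'b topology \<Rightarrow> 'b \<Rightarrow> ('a \<Rightarrow> 'b) \<Rightarrow>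
      ((nat \<Rightarrow> real) \<Rightarrow> 'a) set \<Rightarrow> ((nat \<Rightarrow> real) \<Rightarrow> 'b) set" where
  "homotopy_induced n Y y \<phi> A = (\<Union>f\<in>A. spheroid_class n Y y (\<phi> \<circ> f))"


section \<open>Gottlieb groups\<close>

definition identity_map :: "'a topology \<Rightarrow> 'a \<Rightarrow> 'a" where
  "identity_map Z = (\<lambda>x\<in>topspace Z. x)"

definition aut1 :: "'a topology \<Rightarrow> ('a \<Rightarrow> 'a) topology" where
  "aut1 Z = mapping_component Z Z (identity_map Z)"

definition gottlieb_group ::
    "nat \<Rightarrow> 'a topology \<Rightarrow> 'a \<Rightarrow> ((nat \<Rightarrow> real) \<Rightarrow> 'a) set monoid" where
  "gottlieb_group n Z z =
     (homotopy_group n Z z)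
       \<lparr>carrier := homotopy_induced n Z z (\<lambda>f. f z) `
                    carrier (homotopy_group n (aut1 Z) (identity_map Z))\<rparr>"

definition copies :: "nat \<Rightarrow> 'a monoid \<Rightarrow> (nat \<Rightarrow> 'a) monoid" where
  "copies k G = sum_group {..<k} (\<lambda>_. G)"

end

theory Submission
  imports Defs
begin

text \<open>
  Write \<open>E\<close> for the iterated free loop space \<open>\<Lambda>\<^sup>N Y\<close>, \<open>c\<close> for the map \<open>Y \<rightarrow> E\<close> by constant
  iterated loops, and \<open>M\<close> for the path component of \<open>c\<close> in the space of maps \<open>Y \<rightarrow> E\<close>.

  The space \<open>E\<close> need not be locally compact, so a spheroid in \<open>aut\<^sub>1 E\<close> need not have a continuous
  adjoint on \<open>cube \<times> E\<close>. The way around is that the Gottlieb group of \<open>E\<close> depends on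
  self-maps of \<open>E\<close> only through their restriction along \<open>c\<close>: it is the image of \<open>\<pi>\<^sub>n M\<close> in
  \<open>\<pi>\<^sub>n E\<close> under evaluation at the base point of \<open>Y\<close> (\<open>evaluation_group_iso_gottlieb_group\<close>).
  Restriction along \<open>c\<close> maps \<open>aut\<^sub>1 E\<close> to \<open>M\<close>. In the other direction \<open>M\<close> acts on \<open>E\<close>
  (\<open>exists_action\<close>): for \<open>N = 0\<close> a point of \<open>M\<close> is a self-map of \<open>Y\<close> and acts by evaluation,
  and a free loop coordinate is carried along pointwise. Since \<open>Y\<close> is locally compact Hausdorff,
  evaluation \<open>M \<times> Y \<rightarrow> E\<close> is continuous and everything about \<open>M\<close> reduces to adjunction.

  Interchanging the variable in \<open>Y\<close> with the loop variable identifies the next space \<open>M\<close>, over the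
  next space \<open>E\<close>, with the free loop space of \<open>M\<close>. Thus the step from \<open>N\<close> to \<open>N + 1\<close> replaces a
  map \<open>\<omega> : A \<rightarrow> B\<close> by \<open>\<Lambda>\<omega> : \<Lambda>A \<rightarrow> \<Lambda>B\<close>. For any based map \<open>\<omega>\<close> whose \<open>\<Lambda>\<omega>\<close> has a commutative image
  in \<open>\<pi>\<^sub>n\<close>, that image is the direct product of the images of \<open>\<pi>\<^sub>n \<omega>\<close> and \<open>\<pi>\<^sub>n\<^sub>+\<^sub>1 \<omega>\<close>
  (\<open>image_group_free_loop_space\<close>): constant loops split the evaluation \<open>\<Lambda>B \<rightarrow> B\<close> at \<open>1\<close>, and the
  kernel of evaluation on \<open>\<pi>\<^sub>n\<close> consists of the classes of based loops of spheroids, that is, of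
  spheroids of dimension \<open>n + 1\<close>. Both facts are natural in \<open>\<omega>\<close>, so they pass to images.
  Commutativity comes from the action: \<open>(f, g) \<mapsto> f \<cdot> g(y)\<close> is a pairing \<open>M \<times> M \<rightarrow> E\<close> that restricts
  to evaluation on both axes, and such a pairing makes images of classes commute
  (\<open>comm_group_image_group\<close>).

  Iterating, each of the \<open>N\<close> loop coordinates either is held constant or raises the degree by one.
  The summands are therefore indexed by the sets \<open>J\<close> of coordinates of the second kind, \<open>J\<close>
  contributing the Gottlieb group of degree \<open>n + card J\<close>, and collecting the sets of equal
  cardinality gives the binomial coefficients.
\<close>

section \<open>The compact-open topology\<close>

lemma Union_mapping_subbase:
  "\<Union> {{f \<in> mapping_set X Z. f ` K \<subseteq> U} |K U. compactin X K \<and> openin Z U} = mapping_set X Z"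
  using topspace_mapping_space[of X Z] unfolding mapping_space_def topology_generated_by_topspace .

text \<open>By compactness of \<open>K\<close>: if \<open>F\<close> maps \<open>{p} \<times> K\<close> into the open set \<open>U\<close>, then by the tube lemma
  it maps \<open>A \<times> K\<close> into \<open>U\<close> for a neighbourhood \<open>A\<close> of \<open>p\<close>. The argument covers every \<open>X\<close>, in
  particular the free loop spaces whose self-maps are studied below.\<close>

lemma continuous_map_curry:
  assumes F: "continuous_map (prod_topology P X) Z F"
  shows "continuous_map P (mapping_space X Z) (\<lambda>p. \<lambda>x\<in>topspace X. F (p, x))" (is "continuous_map _ _ ?g")
  unfolding mapping_space_def
proof (rule continuous_on_generated_topo)
  have ms: "?g p \<in> mapping_set X Z" if "p \<in> topspace P" for p
  proof -
    have "continuous_map X Z (F \<circ> Pair p)"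
      using continuous_map_o_Pair[OF F that] .
    then show ?thesis
      unfolding mapping_set_def by (auto elim: continuous_map_eq)
  qed
  show "?g ` topspace P \<subseteq> \<Union> {{f \<in> mapping_set X Z. f ` K \<subseteq> U} |K U. compactin X K \<and> openin Z U}"
    unfolding Union_mapping_subbase using ms by (rule image_subsetI)
  fix W assume "W \<in> {{f \<in> mapping_set X Z. f ` K \<subseteq> U} |K U. compactin X K \<and> openin Z U}"
  then obtain K U where W: "W = {f \<in> mapping_set X Z. f ` K \<subseteq> U}" and K: "compactin X K" and U: "openin Z U"
    by blast
  have KX: "K \<subseteq> topspace X" using K compactin_subset_topspace by blast
  show "openin P (?g -` W \<inter> topspace P)"
  proof (subst openin_subopen, intro ballI)
    fix p assume "p \<in> ?g -` W \<inter> topspace P"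
    then have p: "p \<in> topspace P" and pW: "?g p ` K \<subseteq> U"
      by (auto simp only: W vimage_def Int_iff mem_Collect_eq)
    have pK: "F (p, x) \<in> U" if "x \<in> K" for x
      using subsetD[OF pW imageI[OF that]] subsetD[OF KX that] by simp
    have W': "openin (prod_topology P X) {q \<in> topspace (prod_topology P X). F q \<in> U}"
      using F U by (rule openin_continuous_map_preimage)
    have sub: "{p} \<times> K \<subseteq> {q \<in> topspace (prod_topology P X). F q \<in> U}"
    proof
      fix q assume "q \<in> {p} \<times> K"
      then obtain x where "q = (p, x)" "x \<in> K" by blast
      then show "q \<in> {q \<in> topspace (prod_topology P X). F q \<in> U}"
        using p pK[of x] subsetD[OF KX, of x] by simp
    qed
    obtain A B where A: "openin P A" "p \<in> A" and "K \<subseteq> B"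
      and AB: "A \<times> B \<subseteq> {q \<in> topspace (prod_topology P X). F q \<in> U}"
      using tube_lemma_right[OF W' K p sub] by (elim exE conjE)
    have "q \<in> ?g -` W \<inter> topspace P" if q: "q \<in> A" for q
    proof -
      have qP: "q \<in> topspace P"
        using q openin_subset[OF A(1)] by blast
      have "F (q, x) \<in> U" if "x \<in> K" for x
        using AB q that \<open>K \<subseteq> B\<close> by blast
      then have "?g q ` K \<subseteq> U"
        using subsetD[OF KX] by (simp add: image_subset_iff)
      then show ?thesis
        using ms[OF qP] qP by (simp only: W vimage_def Int_iff mem_Collect_eq)
    qed
    then show "\<exists>T. openin P T \<and> p \<in> T \<and> T \<subseteq> ?g -` W \<inter> topspace P"
      using A by blast
  qed
qed

text \<open>The converse direction of the exponential law, and the place where local compactness acts: near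
  \<open>(f, x)\<close> the point \<open>x\<close> may move in a compact neighbourhood that \<open>f\<close> keeps inside \<open>U\<close>, which is an
  open condition on \<open>f\<close>.\<close>

lemma continuous_map_eval:
  assumes X: "locally_compact_space X" "Hausdorff_space X"
  shows "continuous_map (prod_topology (mapping_space X Z) X) Z (\<lambda>(f, x). f x)"
  unfolding continuous_map_def
proof (intro conjI allI impI)
  show "(\<lambda>(f, x). f x) \<in> topspace (prod_topology (mapping_space X Z) X) \<rightarrow> topspace Z"
    by (auto simp: mapping_set_def continuous_map_def)
next
  fix U assume U: "openin Z U"
  show "openin (prod_topology (mapping_space X Z) X)
      {q \<in> topspace (prod_topology (mapping_space X Z) X). (case q of (f, x) \<Rightarrow> f x) \<in> U}"
    unfolding openin_prod_topology_alt
  proof (intro allI impI)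
    fix f x assume "(f, x) \<in> {q \<in> topspace (prod_topology (mapping_space X Z) X). (case q of (f, x) \<Rightarrow> f x) \<in> U}"
    then have f: "f \<in> mapping_set X Z" and x: "x \<in> topspace X" and fx: "f x \<in> U"
      by auto
    have "openin X {x \<in> topspace X. f x \<in> U}"
      using f U by (auto simp: mapping_set_def intro: openin_continuous_map_preimage)
    moreover have "neighbourhood_base_of (compactin X) X"
      using X locally_compact_space_neighbourhood_base by blast
    ultimately obtain V K where V: "openin X V" "x \<in> V" "V \<subseteq> K" and K: "compactin X K" "K \<subseteq> {x \<in> topspace X. f x \<in> U}"
      using x fx unfolding neighbourhood_base_of by (metis (no_types, lifting) mem_Collect_eq)
    define W where "W = {g \<in> mapping_set X Z. g ` K \<subseteq> U}"
    have "openin (mapping_space X Z) W"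
      unfolding mapping_space_def W_def using K U by (intro topology_generated_by_Basis) auto
    moreover have "f \<in> W"
      using f K by (auto simp: W_def)
    moreover have "W \<times> V \<subseteq> {q \<in> topspace (prod_topology (mapping_space X Z) X). (case q of (f, x) \<Rightarrow> f x) \<in> U}"
      using V openin_subset[OF V(1)] by (auto simp: W_def)
    ultimately show "\<exists>A B. openin (mapping_space X Z) A \<and> openin X B \<and> f \<in> A \<and> x \<in> B \<and>
        A \<times> B \<subseteq> {q \<in> topspace (prod_topology (mapping_space X Z) X). (case q of (f, x) \<Rightarrow> f x) \<in> U}"
      using V by blast
  qed
qed

lemma continuous_map_uncurry:
  assumes X: "locally_compact_space X" "Hausdorff_space X"
    and g: "continuous_map P (mapping_space X Z) g"
    and p: "continuous_map Q P p" and q: "continuous_map Q X q"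
  shows "continuous_map Q Z (\<lambda>w. g (p w) (q w))"
proof -
  have "continuous_map Q (prod_topology (mapping_space X Z) X) (\<lambda>w. (g (p w), q w))"
    using continuous_map_compose[OF p g] q by (simp add: continuous_map_paired comp_def)
  from continuous_map_compose[OF this continuous_map_eval[OF X]] show ?thesis
    by (simp add: comp_def)
qed

text \<open>Proved on the subbase, because the source \<open>X\<close> will be a free loop space, for which no continuous
  evaluation is at hand.\<close>

lemma continuous_map_precompose:
  assumes c: "continuous_map W X c"
  shows "continuous_map (mapping_space X Z) (mapping_space W Z) (\<lambda>g. \<lambda>w\<in>topspace W. g (c w))"
    (is "continuous_map _ _ ?h")
proof -
  have ms: "?h g \<in> mapping_set W Z" if "g \<in> mapping_set X Z" for g
  proof -
    have "continuous_map W Z (g \<circ> c)"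
      using that by (intro continuous_map_compose[OF c]) (simp add: mapping_set_def)
    then show ?thesis
      unfolding mapping_set_def by (auto elim: continuous_map_eq)
  qed
  have sub: "?h ` mapping_set X Z \<subseteq> \<Union> {{f \<in> mapping_set W Z. f ` K \<subseteq> U} |K U. compactin W K \<and> openin Z U}"
    unfolding Union_mapping_subbase using ms by (rule image_subsetI)
  show ?thesis
    unfolding mapping_space_def[of W]
  proof (rule continuous_on_generated_topo)
    fix V assume "V \<in> {{f \<in> mapping_set W Z. f ` K \<subseteq> U} |K U. compactin W K \<and> openin Z U}"
    then obtain K U where V: "V = {f \<in> mapping_set W Z. f ` K \<subseteq> U}" and K: "compactin W K" and U: "openin Z U"
      by blast
    have KW: "K \<subseteq> topspace W" using K compactin_subset_topspace by blast
    have *: "?h -` V \<inter> mapping_set X Z = {g \<in> mapping_set X Z. g ` (c ` K) \<subseteq> U}"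
    proof (intro Set.set_eqI iffI)
      fix g assume "g \<in> ?h -` V \<inter> mapping_set X Z"
      then have "g \<in> mapping_set X Z" "?h g ` K \<subseteq> U"
        by (simp_all only: V vimage_def Int_iff mem_Collect_eq)
      then show "g \<in> {g \<in> mapping_set X Z. g ` (c ` K) \<subseteq> U}"
        using subsetD[OF KW] by (simp add: image_subset_iff)
    next
      fix g assume "g \<in> {g \<in> mapping_set X Z. g ` (c ` K) \<subseteq> U}"
      then have g: "g \<in> mapping_set X Z" "g ` (c ` K) \<subseteq> U"
        by simp_all
      then have "?h g ` K \<subseteq> U"
        using subsetD[OF KW] by (simp add: image_subset_iff)
      with g ms[OF g(1)] show "g \<in> ?h -` V \<inter> mapping_set X Z"
        by (simp only: V vimage_def Int_iff mem_Collect_eq)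
    qed
    have "openin (mapping_space X Z) {g \<in> mapping_set X Z. g ` (c ` K) \<subseteq> U}"
      unfolding mapping_space_def using image_compactin[OF K c] U
      by (intro topology_generated_by_Basis) auto
    then show "openin (mapping_space X Z) (?h -` V \<inter> topspace (mapping_space X Z))"
      by (simp only: * topspace_mapping_space)
  qed (use sub in simp)
qed

lemma path_connected_space_mapping_component:
  "path_connected_space (mapping_component X Z f)"
  unfolding mapping_component_def
  using path_connectedin_path_component_of[of "mapping_space X Z" f] by (simp add: path_connectedin_def)

lemma topspace_mapping_component:
  "topspace (mapping_component X Z f) = Collect (path_component_of (mapping_space X Z) f)"
proof -
  have "Collect (path_component_of (mapping_space X Z) f) \<subseteq> topspace (mapping_space X Z)"
    using path_component_in_topspace[of "mapping_space X Z" f] by blast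
  then show ?thesis
    by (simp only: mapping_component_def topspace_subtopology Int_absorb1)
qed

lemma mem_mapping_componentD:
  "g \<in> topspace (mapping_component X Z f) \<Longrightarrow> g \<in> extensional (topspace X) \<and> continuous_map X Z g"
  unfolding mapping_component_def by (auto simp: mapping_set_def)

lemma base_in_mapping_component:
  assumes "continuous_map X Z f" "f \<in> extensional (topspace X)"
  shows "f \<in> topspace (mapping_component X Z f)"
  using assms by (simp add: topspace_mapping_component path_component_of_refl mapping_set_def)

lemma continuous_map_into_mapping_space:
  "continuous_map P (mapping_component X Z f) g \<Longrightarrow> continuous_map P (mapping_space X Z) g"
  by (simp add: mapping_component_def continuous_map_in_subtopology)

text \<open>Landing in a prescribed path component costs nothing for maps out of a path connected space. This
  is how all component conditions below are met.\<close>

lemma continuous_map_into_mapping_component: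
  assumes P: "path_connected_space P" "p \<in> topspace P"
    and g: "continuous_map P (mapping_space X Z) g" "g p = f"
  shows "continuous_map P (mapping_component X Z f) g"
proof -
  have "path_component_of P p q" if "q \<in> topspace P" for q
    using P that by (simp add: path_connected_space_iff_path_component)
  then have "path_component_of (mapping_space X Z) f (g q)" if "q \<in> topspace P" for q
    using path_component_of_continuous_image[OF g(1)] g(2) that by blast
  then show ?thesis
    using g(1) by (auto simp: mapping_component_def continuous_map_in_subtopology)
qed

lemma continuous_map_curry_component:
  assumes P: "path_connected_space P" "p \<in> topspace P"
    and F: "continuous_map (prod_topology P X) Z F"
    and f: "f \<in> extensional (topspace X)" "\<And>x. x \<in> topspace X \<Longrightarrow> F (p, x) = f x"
  shows "continuous_map P (mapping_component X Z f) (\<lambda>p. \<lambda>x\<in>topspace X. F (p, x))"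
  using f by (intro continuous_map_into_mapping_component[OF P] continuous_map_curry[OF F])
    (auto intro: extensionalityI)

lemma continuous_map_uncurry_component:
  assumes X: "locally_compact_space X" "Hausdorff_space X"
    and g: "continuous_map P (mapping_component X Z f) g"
    and p: "continuous_map Q P p" and q: "continuous_map Q X q"
  shows "continuous_map Q Z (\<lambda>w. g (p w) (q w))"
  using continuous_map_uncurry[OF X continuous_map_into_mapping_space[OF g] p q] .

section \<open>Maps into intervals and cubes\<close>

lemma continuous_map_compose2:
  assumes H: "continuous_map (prod_topology A B) X (\<lambda>q. H (fst q) (snd q))"
    and a: "continuous_map Q A a" and b: "continuous_map Q B b"
  shows "continuous_map Q X (\<lambda>q. H (a q) (b q))"
proof -
  have "continuous_map Q (prod_topology A B) (\<lambda>q. (a q, b q))"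
    using a b by (simp add: continuous_map_paired)
  from continuous_map_compose[OF this H] show ?thesis
    by (simp add: comp_def)
qed

lemma continuous_map_compose1:
  assumes "continuous_map A X f" "continuous_map Q A a"
  shows "continuous_map Q X (\<lambda>q. f (a q))"
  using continuous_map_compose[OF assms(2,1)] by (simp add: comp_def)

lemma continuous_map_from_interval:
  assumes "continuous_map Q unit_interval u"
  shows "continuous_map Q euclideanreal u"
  using assms by (simp add: continuous_map_in_subtopology)

lemma continuous_map_real_compose:
  assumes "continuous_map Q euclideanreal u" "continuous_on UNIV \<phi>"
  shows "continuous_map Q euclideanreal (\<lambda>q. \<phi> (u q) :: real)"
  using continuous_map_compose1[of euclideanreal euclideanreal \<phi> Q u] assms by simp

lemma continuous_map_into_interval:
  assumes "continuous_map Q euclideanreal u" "\<And>q. q \<in> topspace Q \<Longrightarrow> 0 \<le> u q \<and> u q \<le> 1"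
  shows "continuous_map Q unit_interval u"
  using assms by (auto simp: continuous_map_in_subtopology)

lemma topspace_cube: "topspace (cube n) = PiE {..<n} (\<lambda>_. {0..1})"
  by (simp add: cube_def)

lemma cube_coord:
  assumes "p \<in> topspace (cube n)" "k < n"
  shows "0 \<le> p k" "p k \<le> 1"
  using assms by (auto simp: topspace_cube PiE_iff)

lemma cube_upd: "p \<in> topspace (cube n) \<Longrightarrow> k < n \<Longrightarrow> 0 \<le> u \<Longrightarrow> u \<le> 1 \<Longrightarrow> p(k := u) \<in> topspace (cube n)"
  by (auto simp: topspace_cube PiE_iff extensional_def)

text \<open>A cube of dimension \<open>n + 1\<close> is a cube of dimension \<open>n\<close> times an interval; points of the smaller
  cube are \<^const>\<open>undefined\<close> at the index \<open>n\<close>.\<close>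

lemma cube_extend: "p \<in> topspace (cube n) \<Longrightarrow> 0 \<le> u \<Longrightarrow> u \<le> 1 \<Longrightarrow> p(n := u) \<in> topspace (cube (Suc n))"
  by (auto simp: topspace_cube PiE_iff extensional_def)

lemma cube_drop: "p \<in> topspace (cube (Suc n)) \<Longrightarrow> p(n := undefined) \<in> topspace (cube n)"
  by (auto simp: topspace_cube PiE_iff extensional_def)

lemma cube_undefined: "p \<in> topspace (cube n) \<Longrightarrow> p n = undefined"
  by (auto simp: topspace_cube PiE_iff extensional_def)

lemma continuous_map_into_cube:
  "continuous_map P (cube n) f \<longleftrightarrow>
     f ` topspace P \<subseteq> extensional {..<n} \<and> (\<forall>k<n. continuous_map P unit_interval (\<lambda>x. f x k))"
  by (simp add: cube_def continuous_map_componentwise Ball_def)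

lemma continuous_map_cube_coord:
  "continuous_map P (cube n) f \<Longrightarrow> k < n \<Longrightarrow> continuous_map P euclideanreal (\<lambda>x. f x k)"
  by (auto simp: continuous_map_into_cube intro: continuous_map_from_interval)

lemma continuous_map_cube_upd:
  assumes "continuous_map P (cube n) f" "continuous_map P unit_interval u" "k < n"
  shows "continuous_map P (cube n) (\<lambda>x. (f x)(k := u x))"
  using assms by (auto simp: continuous_map_into_cube extensional_def)

lemma continuous_map_cube_extend:
  assumes "continuous_map P (cube n) f" "continuous_map P unit_interval u"
  shows "continuous_map P (cube (Suc n)) (\<lambda>x. (f x)(n := u x))"
  using assms by (auto simp: continuous_map_into_cube extensional_def less_Suc_eq)

lemma continuous_map_cube_drop:
  assumes "continuous_map P (cube (Suc n)) f"
  shows "continuous_map P (cube n) (\<lambda>x. (f x)(n := undefined))"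
  using assms by (auto simp: continuous_map_into_cube extensional_def less_Suc_eq)

lemma path_connected_cube: "path_connected_space (cube n)"
  by (simp add: cube_def path_connected_space_product_topology path_connectedin_def[symmetric]
      is_interval_path_connected)

lemma compact_cube: "compact_space (cube n)"
  by (simp add: cube_def compact_space_product_topology compact_space_subtopology)

lemma Hausdorff_cube: "Hausdorff_space (cube n)"
  by (simp add: cube_def Hausdorff_space_product_topology Hausdorff_space_subtopology)

lemma cube_boundary_subset: "p \<in> cube_boundary n \<Longrightarrow> p \<in> topspace (cube n)"
  by (simp add: cube_boundary_def)

lemma cube_boundary_nonempty:
  assumes "n \<ge> 1"
  obtains p where "p \<in> cube_boundary n"
proof
  show "(\<lambda>i\<in>{..<n}. 0) \<in> cube_boundary n"
    using assms by (auto simp: cube_boundary_def topspace_cube intro!: exI[of _ 0])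
qed

section \<open>Homotopies of spheroids\<close>

lemma spheroid_homotopicI:
  fixes H :: "real \<Rightarrow> (nat \<Rightarrow> real) \<Rightarrow> 'a"
  assumes H: "continuous_map (prod_topology unit_interval (cube n)) X (\<lambda>q. H (fst q) (snd q))"
    and "\<And>p. p \<in> topspace (cube n) \<Longrightarrow> H 0 p = f p" "\<And>p. p \<in> topspace (cube n) \<Longrightarrow> H 1 p = g p"
    and "\<And>t p. 0 \<le> t \<Longrightarrow> t \<le> 1 \<Longrightarrow> p \<in> cube_boundary n \<Longrightarrow> H t p = x"
  shows "spheroid_homotopic n X x f g"
proof -
  have "(\<forall>p\<in>cube_boundary n. h p = x) \<longleftrightarrow> (\<forall>p\<in>cube_boundary n. k p = x)"
    if "\<And>p. p \<in> topspace (cube n) \<Longrightarrow> h p = k p" for h k :: "(nat \<Rightarrow> real) \<Rightarrow> 'a"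
    by (intro ball_cong refl) (simp add: that cube_boundary_subset)
  then have *: "spheroid_homotopic n X x f g \<longleftrightarrow>
      (\<exists>h. continuous_map (prod_topology unit_interval (cube n)) X h \<and>
        (\<forall>p\<in>topspace (cube n). h (0, p) = f p) \<and> (\<forall>p\<in>topspace (cube n). h (1, p) = g p) \<and>
        (\<forall>t\<in>{0..1}. \<forall>p\<in>cube_boundary n. h (t, p) = x))"
    unfolding spheroid_homotopic_def by (rule homotopic_with)
  show ?thesis
    unfolding * by (rule exI[of _ "\<lambda>q. H (fst q) (snd q)"]) (simp add: assms)
qed

lemma spheroid_homotopicE:
  assumes "spheroid_homotopic n X x f g"
  obtains H :: "real \<Rightarrow> (nat \<Rightarrow> real) \<Rightarrow> 'a"
  where "continuous_map (prod_topology unit_interval (cube n)) X (\<lambda>q. H (fst q) (snd q))"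
    and "\<And>p. H 0 p = f p" "\<And>p. H 1 p = g p"
    and "\<And>t p. 0 \<le> t \<Longrightarrow> t \<le> 1 \<Longrightarrow> p \<in> cube_boundary n \<Longrightarrow> H t p = x"
proof -
  obtain h where "continuous_map (prod_topology unit_interval (cube n)) X h"
    "\<forall>p. h (0, p) = f p" "\<forall>p. h (1, p) = g p" "\<forall>t\<in>{0..1}. \<forall>p\<in>cube_boundary n. h (t, p) = x"
    using assms unfolding spheroid_homotopic_def homotopic_with_def by blast
  then show ?thesis
    by (intro that[of "\<lambda>t p. h (t, p)"]) auto
qed

lemma spheroid_homotopic_imp_spheroid:
  assumes "spheroid_homotopic n X x f g"
  shows "spheroid n X x f" "spheroid n X x g"
  using homotopic_with_imp_continuous_maps[of _ "cube n" X f g]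
    homotopic_with_imp_property[of _ "cube n" X f g] assms
  unfolding spheroid_homotopic_def spheroid_def by blast+

lemma spheroid_homotopic_eq:
  assumes "spheroid n X x f" "\<And>p. p \<in> topspace (cube n) \<Longrightarrow> f p = g p"
  shows "spheroid_homotopic n X x f g"
  unfolding spheroid_homotopic_def
  using assms by (intro homotopic_with_equal) (auto simp: spheroid_def cube_boundary_def)

lemma spheroid_homotopic_refl: "spheroid n X x f \<Longrightarrow> spheroid_homotopic n X x f f"
  by (simp add: spheroid_homotopic_eq)

lemma spheroid_homotopic_sym: "spheroid_homotopic n X x f g \<Longrightarrow> spheroid_homotopic n X x g f"
  unfolding spheroid_homotopic_def by (rule homotopic_with_symD)

lemma spheroid_homotopic_trans [trans]:
  "spheroid_homotopic n X x f g \<Longrightarrow> spheroid_homotopic n X x g h \<Longrightarrow> spheroid_homotopic n X x f h"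
  unfolding spheroid_homotopic_def by (rule homotopic_with_trans)

lemma spheroid_class_eqI: "spheroid_homotopic n X x f g \<Longrightarrow> spheroid_class n X x f = spheroid_class n X x g"
  unfolding spheroid_class_def
  by (intro Collect_cong iffI) (erule (1) spheroid_homotopic_trans[OF spheroid_homotopic_sym] spheroid_homotopic_trans)+

lemma spheroid_class_eq_iff:
  assumes "spheroid n X x g"
  shows "spheroid_class n X x f = spheroid_class n X x g \<longleftrightarrow> spheroid_homotopic n X x f g"
proof
  assume "spheroid_class n X x f = spheroid_class n X x g"
  moreover have "g \<in> spheroid_class n X x g"
    using spheroid_homotopic_refl[OF assms] by (simp add: spheroid_class_def)
  ultimately show "spheroid_homotopic n X x f g"
    by (metis mem_Collect_eq spheroid_class_def)
qed (rule spheroid_class_eqI)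

lemma spheroid_in_class: "spheroid n X x f \<Longrightarrow> f \<in> spheroid_class n X x f"
  by (simp add: spheroid_class_def spheroid_homotopic_refl)

lemma spheroid_const: "x \<in> topspace X \<Longrightarrow> spheroid n X x (\<lambda>_. x)"
  by (simp add: spheroid_def)

lemma spheroid_boundary: "spheroid n X x f \<Longrightarrow> p \<in> cube_boundary n \<Longrightarrow> f p = x"
  by (simp add: spheroid_def)

lemma spheroid_continuous: "spheroid n X x f \<Longrightarrow> continuous_map (cube n) X f"
  by (simp add: spheroid_def)

lemma spheroid_base:
  assumes "spheroid n X x f" "n \<ge> 1"
  shows "x \<in> topspace X"
proof -
  obtain p where p: "p \<in> cube_boundary n"
    using cube_boundary_nonempty[OF assms(2)] .
  have "f p \<in> topspace X"
    using spheroid_continuous[OF assms(1)] cube_boundary_subset[OF p]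
    by (auto simp: continuous_map_def)
  then show ?thesis
    by (simp add: spheroid_boundary[OF assms(1) p])
qed

lemma spheroid_compose:
  assumes "spheroid n X x f" "continuous_map X Y \<phi>" "\<phi> x = y"
  shows "spheroid n Y y (\<phi> \<circ> f)"
  using assms by (auto simp: spheroid_def intro: continuous_map_compose)

lemma spheroid_homotopic_compose:
  assumes "spheroid_homotopic n X x f g" "continuous_map X Y \<phi>" "\<phi> x = y"
  shows "spheroid_homotopic n Y y (\<phi> \<circ> f) (\<phi> \<circ> g)"
proof -
  obtain H where H: "continuous_map (prod_topology unit_interval (cube n)) X (\<lambda>q. H (fst q) (snd q))"
    "\<And>p. H 0 p = f p" "\<And>p. H 1 p = g p"
    "\<And>t p. 0 \<le> t \<Longrightarrow> t \<le> 1 \<Longrightarrow> p \<in> cube_boundary n \<Longrightarrow> H t p = x"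
    using assms(1) by (rule spheroid_homotopicE) blast
  show ?thesis
    by (rule spheroid_homotopicI[where H = "\<lambda>t p. \<phi> (H t p)"])
      (use H assms(3) continuous_map_compose1[OF assms(2) H(1)] in auto)
qed

lemma cube_boundary_upd:
  assumes "p \<in> cube_boundary n" "k < n" "0 \<le> u" "u \<le> 1" "p k = 0 \<or> p k = 1 \<Longrightarrow> u = 0 \<or> u = 1"
  shows "p(k := u) \<in> cube_boundary n"
proof -
  obtain i where i: "i < n" "p i = 0 \<or> p i = 1" and p: "p \<in> topspace (cube n)"
    using assms(1) by (auto simp: cube_boundary_def)
  show ?thesis
    unfolding cube_boundary_def using i assms cube_upd[OF p assms(2-4)]
    by (auto intro!: exI[of _ i])
qed

lemma cube_boundary_face:
  assumes "p \<in> topspace (cube n)" "k < n" "u = 0 \<or> u = 1"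
  shows "p(k := u) \<in> cube_boundary n"
  using assms cube_upd[OF assms(1,2), of u] by (auto simp: cube_boundary_def)

text \<open>The homotopies of the two factors are run side by side.\<close>

lemma spheroid_homotopic_concat:
  assumes n: "n \<ge> 1" and f: "spheroid_homotopic n X x f f'" and g: "spheroid_homotopic n X x g g'"
  shows "spheroid_homotopic n X x (spheroid_concat f g) (spheroid_concat f' g')"
proof -
  obtain H where H: "continuous_map (prod_topology unit_interval (cube n)) X (\<lambda>q. H (fst q) (snd q))"
    "\<And>p. H 0 p = f p" "\<And>p. H 1 p = f' p"
    "\<And>t p. 0 \<le> t \<Longrightarrow> t \<le> 1 \<Longrightarrow> p \<in> cube_boundary n \<Longrightarrow> H t p = x"
    using f by (rule spheroid_homotopicE) blast
  obtain K where K: "continuous_map (prod_topology unit_interval (cube n)) X (\<lambda>q. K (fst q) (snd q))"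
    "\<And>p. K 0 p = g p" "\<And>p. K 1 p = g' p"
    "\<And>t p. 0 \<le> t \<Longrightarrow> t \<le> 1 \<Longrightarrow> p \<in> cube_boundary n \<Longrightarrow> K t p = x"
    using g by (rule spheroid_homotopicE) blast
  have n0: "0 < n" using n by simp
  \<comment> \<open>The clamps make both branches continuous on the whole cube, so that they can be pasted.\<close>
  define L where "L = (\<lambda>t p. if p 0 \<le> 1/2 then H t (p(0 := min 1 (2 * p 0))) else K t (p(0 := max 0 (2 * p 0 - 1))))"
  let ?Q = "prod_topology unit_interval (cube n)"
  have p0: "continuous_map ?Q euclideanreal (\<lambda>q. snd q 0)"
    using continuous_map_cube_coord[OF continuous_map_snd n0] .
  have rng: "0 \<le> p 0 \<and> p 0 \<le> 1" if "p \<in> topspace (cube n)" for p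
    using cube_coord[OF that n0] by simp
  show ?thesis
  proof (rule spheroid_homotopicI)
    show "continuous_map ?Q X (\<lambda>q. L (fst q) (snd q))"
      unfolding L_def
    proof (rule continuous_map_cases_le[OF p0])
      have 1: "continuous_map ?Q unit_interval (\<lambda>q. min 1 (2 * snd q 0))"
        using rng by (intro continuous_map_into_interval continuous_intros p0) auto
      have 2: "continuous_map ?Q unit_interval (\<lambda>q. max 0 (2 * snd q 0 - 1))"
        using rng by (intro continuous_map_into_interval continuous_intros p0) auto
      show "continuous_map (subtopology ?Q S) X (\<lambda>q. H (fst q) ((snd q)(0 := min 1 (2 * snd q 0))))" for S
        by (intro continuous_map_from_subtopology continuous_map_compose2[OF H(1)]
            continuous_map_cube_upd continuous_map_fst continuous_map_snd 1 n0)
      show "continuous_map (subtopology ?Q S) X (\<lambda>q. K (fst q) ((snd q)(0 := max 0 (2 * snd q 0 - 1))))" for S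
        by (intro continuous_map_from_subtopology continuous_map_compose2[OF K(1)]
            continuous_map_cube_upd continuous_map_fst continuous_map_snd 2 n0)
      show "H (fst q) ((snd q)(0 := min 1 (2 * snd q 0))) = K (fst q) ((snd q)(0 := max 0 (2 * snd q 0 - 1)))"
        if "q \<in> topspace ?Q" "snd q 0 = 1/2" for q
        using that H(4) K(4) by (auto simp: cube_boundary_face n0)
    qed simp
    show "L 0 p = spheroid_concat f g p" "L 1 p = spheroid_concat f' g' p" if "p \<in> topspace (cube n)" for p
      using rng[OF that] by (auto simp: L_def spheroid_concat_def H K)
    show "L t p = x" if "0 \<le> t" "t \<le> 1" "p \<in> cube_boundary n" for t p
      unfolding L_def using that rng[OF cube_boundary_subset[OF that(3)]]
      by (auto intro!: H K cube_boundary_upd simp: n0)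
  qed
qed

lemma spheroid_concat:
  assumes "n \<ge> 1" "spheroid n X x f" "spheroid n X x g"
  shows "spheroid n X x (spheroid_concat f g)"
  by (rule spheroid_homotopic_imp_spheroid(1)[OF spheroid_homotopic_concat[OF assms(1)
        spheroid_homotopic_refl[OF assms(2)] spheroid_homotopic_refl[OF assms(3)]]])

text \<open>Two self-maps of the interval that agree at the end points, and send them to end points, are
  joined by straight lines without leaving the interval. All group axioms are instances of this: each
  of them compares two reparametrizations of a single spheroid in the first coordinate.\<close>

lemma spheroid_homotopic_reparametrize:
  fixes \<phi> \<psi> :: "real \<Rightarrow> real"
  assumes n: "n \<ge> 1" and f: "spheroid n X x f"
    and cont: "continuous_on UNIV \<phi>" "continuous_on UNIV \<psi>"
    and rng: "\<And>t. 0 \<le> t \<Longrightarrow> t \<le> 1 \<Longrightarrow> 0 \<le> \<phi> t \<and> \<phi> t \<le> 1" "\<And>t. 0 \<le> t \<Longrightarrow> t \<le> 1 \<Longrightarrow> 0 \<le> \<psi> t \<and> \<psi> t \<le> 1"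
    and ends: "\<phi> 0 = \<psi> 0" "\<phi> 0 \<in> {0, 1}" "\<phi> 1 = \<psi> 1" "\<phi> 1 \<in> {0, 1}"
  shows "spheroid_homotopic n X x (\<lambda>p. f (p(0 := \<phi> (p 0)))) (\<lambda>p. f (p(0 := \<psi> (p 0))))"
proof -
  have n0: "0 < n" using n by simp
  define L where "L = (\<lambda>t p. f (p(0 := (1 - t) * \<phi> (p 0) + t * \<psi> (p 0))))"
  let ?Q = "prod_topology unit_interval (cube n)"
  have p0: "continuous_map ?Q euclideanreal (\<lambda>q. snd q 0)"
    using continuous_map_cube_coord[OF continuous_map_snd n0] .
  have t0: "continuous_map ?Q euclideanreal fst"
    by (rule continuous_map_from_interval[OF continuous_map_fst])
  have conv: "0 \<le> (1 - t) * \<phi> (p 0) + t * \<psi> (p 0) \<and> (1 - t) * \<phi> (p 0) + t * \<psi> (p 0) \<le> 1"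
    if "p \<in> topspace (cube n)" "0 \<le> t" "t \<le> 1" for p t
    using rng[OF cube_coord[OF that(1) n0]] that(2,3)
      convex_bound_le[of "\<phi> (p 0)" 1 "\<psi> (p 0)" "1 - t" t] by auto
  show ?thesis
  proof (rule spheroid_homotopicI)
    have "continuous_map ?Q unit_interval (\<lambda>q. (1 - fst q) * \<phi> (snd q 0) + fst q * \<psi> (snd q 0))"
      using conv
      by (intro continuous_map_into_interval continuous_intros t0
          continuous_map_real_compose[OF p0 cont(1)] continuous_map_real_compose[OF p0 cont(2)]) auto
    then show "continuous_map ?Q X (\<lambda>q. L (fst q) (snd q))"
      unfolding L_def
      by (intro continuous_map_compose1[OF spheroid_continuous[OF f]] continuous_map_cube_upd continuous_map_snd n0)
    show "L t p = x" if "0 \<le> t" "t \<le> 1" "p \<in> cube_boundary n" for t p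
      unfolding L_def
    proof (intro spheroid_boundary[OF f] cube_boundary_upd that n0)
      show "(1 - t) * \<phi> (p 0) + t * \<psi> (p 0) = 0 \<or> (1 - t) * \<phi> (p 0) + t * \<psi> (p 0) = 1"
        if "p 0 = 0 \<or> p 0 = 1"
        using that ends by (auto simp: algebra_simps)
    qed (use conv[OF cube_boundary_subset] that in auto)
  qed (simp_all add: L_def)
qed

definition spheroid_reverse :: "((nat \<Rightarrow> real) \<Rightarrow> 'a) \<Rightarrow> (nat \<Rightarrow> real) \<Rightarrow> 'a" where
  "spheroid_reverse f = (\<lambda>p. f (p(0 := 1 - p 0)))"

lemma spheroid_reverse:
  assumes n: "n \<ge> 1" and f: "spheroid n X x f"
  shows "spheroid n X x (spheroid_reverse f)"
  unfolding spheroid_reverse_def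
  by (rule spheroid_homotopic_imp_spheroid(1), rule spheroid_homotopic_reparametrize[OF assms, where \<psi> = "\<lambda>t. 1 - t"])
    (auto intro!: continuous_intros)

text \<open>The concatenation is \<open>f\<close> reparametrized by \<open>\<bar>1 - 2 t\<bar>\<close>, a path from \<open>1\<close> to \<open>1\<close>, which contracts
  to the constant path at \<open>1\<close>.\<close>

lemma spheroid_concat_reverse:
  assumes n: "n \<ge> 1" and f: "spheroid n X x f"
  shows "spheroid_homotopic n X x (spheroid_concat (spheroid_reverse f) f) (\<lambda>_. x)"
proof -
  have n0: "0 < n" using n by simp
  have "spheroid_homotopic n X x (spheroid_concat (spheroid_reverse f) f) (\<lambda>p. f (p(0 := \<bar>1 - 2 * p 0\<bar>)))"
    by (rule spheroid_homotopic_eq[OF spheroid_concat[OF n spheroid_reverse[OF assms] f]])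
      (auto simp: spheroid_concat_def spheroid_reverse_def)
  also have "spheroid_homotopic n X x (\<lambda>p. f (p(0 := \<bar>1 - 2 * p 0\<bar>))) (\<lambda>p. f (p(0 := 1)))"
    by (rule spheroid_homotopic_reparametrize[OF assms, where \<psi> = "\<lambda>t. 1"]) (auto intro!: continuous_intros)
  also have "spheroid_homotopic n X x (\<lambda>p. f (p(0 := 1))) (\<lambda>_. x)"
    by (rule spheroid_homotopic_sym, rule spheroid_homotopic_eq[OF spheroid_const[OF spheroid_base[OF f n]]])
      (simp add: spheroid_boundary[OF f] cube_boundary_face n0)
  finally show ?thesis .
qed

lemma spheroid_homotopic_identity_reparam:
  assumes n: "n \<ge> 1" and f: "spheroid n X x f" and "continuous_on UNIV \<phi>"
    and "\<And>t. 0 \<le> t \<Longrightarrow> t \<le> 1 \<Longrightarrow> 0 \<le> \<phi> t \<and> \<phi> t \<le> (1::real)" "\<phi> 0 = 0" "\<phi> 1 = 1"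
    and g: "\<And>p. p \<in> topspace (cube n) \<Longrightarrow> g p = f (p(0 := \<phi> (p 0)))"
  shows "spheroid_homotopic n X x g f"
proof -
  have *: "spheroid_homotopic n X x (\<lambda>p. f (p(0 := \<phi> (p 0)))) (\<lambda>p. f (p(0 := p 0)))"
    using assms by (intro spheroid_homotopic_reparametrize[where \<psi> = "\<lambda>t. t"]) auto
  have "spheroid_homotopic n X x (\<lambda>p. f (p(0 := \<phi> (p 0)))) g"
    using g by (intro spheroid_homotopic_eq spheroid_homotopic_imp_spheroid(1)[OF *]) simp
  then show ?thesis
    using * spheroid_homotopic_sym spheroid_homotopic_trans by (metis (no_types, lifting) ext fun_upd_triv)
qed

lemma spheroid_concat_const_left:
  assumes n: "n \<ge> 1" and f: "spheroid n X x f"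
  shows "spheroid_homotopic n X x (spheroid_concat (\<lambda>_. x) f) f"
proof (rule spheroid_homotopic_identity_reparam[OF assms, where \<phi> = "\<lambda>t. max 0 (2 * t - 1)"])
  fix p assume p: "p \<in> topspace (cube n)"
  then show "spheroid_concat (\<lambda>_. x) f p = f (p(0 := max 0 (2 * p 0 - 1)))"
    using n spheroid_boundary[OF f cube_boundary_face[OF p, of 0 0]]
    by (cases "p 0 \<le> 1/2") (simp_all add: spheroid_concat_def max_absorb1 max_absorb2)
qed (auto intro!: continuous_intros)

lemma spheroid_concat_const_right:
  assumes n: "n \<ge> 1" and f: "spheroid n X x f"
  shows "spheroid_homotopic n X x (spheroid_concat f (\<lambda>_. x)) f"
proof (rule spheroid_homotopic_identity_reparam[OF assms, where \<phi> = "\<lambda>t. min 1 (2 * t)"])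
  fix p assume p: "p \<in> topspace (cube n)"
  then show "spheroid_concat f (\<lambda>_. x) p = f (p(0 := min 1 (2 * p 0)))"
    using n spheroid_boundary[OF f cube_boundary_face[OF p, of 0 1]]
    by (cases "p 0 \<le> 1/2") (simp_all add: spheroid_concat_def min_absorb1 min_absorb2)
qed (auto intro!: continuous_intros)

text \<open>The two bracketings differ by the piecewise linear reparametrization that sends \<open>1/4, 1/2\<close> to
  \<open>1/2, 3/4\<close>. It is concave with slopes \<open>2, 1, 1/2\<close>, hence a minimum of three affine functions.\<close>

lemma spheroid_concat_assoc:
  assumes n: "n \<ge> 1" and f: "spheroid n X x f" and g: "spheroid n X x g" and h: "spheroid n X x h"
  shows "spheroid_homotopic n X x (spheroid_concat (spheroid_concat f g) h) (spheroid_concat f (spheroid_concat g h))"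
proof (rule spheroid_homotopic_identity_reparam[OF n, where \<phi> = "\<lambda>t. min (2 * t) (min (t + 1/4) ((t + 1) / 2))"])
  fix p :: "nat \<Rightarrow> real"
  consider "p 0 \<le> 1/4" | "1/4 < p 0" "p 0 \<le> 1/2" | "1/2 < p 0"
    by linarith
  then show "spheroid_concat (spheroid_concat f g) h p =
      spheroid_concat f (spheroid_concat g h) (p(0 := min (2 * p 0) (min (p 0 + 1/4) ((p 0 + 1) / 2))))"
  proof cases
    case 1
    then have "min (2 * p 0) (min (p 0 + 1/4) ((p 0 + 1) / 2)) = 2 * p 0"
      by (auto simp: min_def)
    with 1 show ?thesis
      by (simp add: spheroid_concat_def)
  next
    case 2
    then have "min (2 * p 0) (min (p 0 + 1/4) ((p 0 + 1) / 2)) = p 0 + 1/4"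
      by (auto simp: min_def)
    with 2 show ?thesis
      by (simp add: spheroid_concat_def algebra_simps)
  next
    case 3
    then have "min (2 * p 0) (min (p 0 + 1/4) ((p 0 + 1) / 2)) = (p 0 + 1) / 2"
      by (auto simp: min_def)
    with 3 show ?thesis
      by (simp add: spheroid_concat_def add_divide_distrib)
  qed
qed (auto simp: min_le_iff_disj intro!: continuous_intros spheroid_concat assms)

section \<open>The group structure on homotopy groups\<close>

lemma carrier_homotopy_group: "carrier (homotopy_group n X x) = spheroid_class n X x ` Collect (spheroid n X x)"
  and one_homotopy_group: "\<one>\<^bsub>homotopy_group n X x\<^esub> = spheroid_class n X x (\<lambda>_. x)"
  by (simp_all add: homotopy_group_def)

lemma UN_eqI: "a \<in> A \<Longrightarrow> (\<And>b. b \<in> A \<Longrightarrow> F b = C) \<Longrightarrow> (\<Union>b\<in>A. F b) = C"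
  by auto

lemma mult_homotopy_group:
  assumes n: "n \<ge> 1" and f: "spheroid n X x f" and g: "spheroid n X x g"
  shows "spheroid_class n X x f \<otimes>\<^bsub>homotopy_group n X x\<^esub> spheroid_class n X x g
       = spheroid_class n X x (spheroid_concat f g)"
proof -
  have "spheroid_class n X x (spheroid_concat f' g') = spheroid_class n X x (spheroid_concat f g)"
    if "f' \<in> spheroid_class n X x f" "g' \<in> spheroid_class n X x g" for f' g'
  proof -
    have "spheroid_homotopic n X x f f'" "spheroid_homotopic n X x g g'"
      using that by (simp_all add: spheroid_class_def)
    then show ?thesis
      by (rule spheroid_class_eqI[OF spheroid_homotopic_sym[OF spheroid_homotopic_concat[OF n]]])
  qed
  then show ?thesis
    unfolding homotopy_group_def monoid.simps
    by (intro UN_eqI[OF spheroid_in_class[OF f]] UN_eqI[OF spheroid_in_class[OF g]])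
qed

lemma homotopy_groupE:
  assumes "A \<in> carrier (homotopy_group n X x)"
  obtains f where "spheroid n X x f" "A = spheroid_class n X x f"
  using assms by (auto simp: carrier_homotopy_group)

lemma spheroid_class_in_carrier: "spheroid n X x f \<Longrightarrow> spheroid_class n X x f \<in> carrier (homotopy_group n X x)"
  by (simp add: carrier_homotopy_group)

lemma l_inv_homotopy_group:
  assumes n: "n \<ge> 1" and f: "spheroid n X x f"
  shows "spheroid_class n X x (spheroid_reverse f) \<otimes>\<^bsub>homotopy_group n X x\<^esub> spheroid_class n X x f
      = \<one>\<^bsub>homotopy_group n X x\<^esub>"
  unfolding mult_homotopy_group[OF n spheroid_reverse[OF n f] f] one_homotopy_group
  by (rule spheroid_class_eqI[OF spheroid_concat_reverse[OF n f]])

lemma group_homotopy_group: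
  assumes n: "n \<ge> 1" and x: "x \<in> topspace X"
  shows "group (homotopy_group n X x)"
proof (rule groupI)
  let ?G = "homotopy_group n X x"
  note [simp] = mult_homotopy_group[OF n] spheroid_concat[OF n] spheroid_class_in_carrier
  show "\<one>\<^bsub>?G\<^esub> \<in> carrier ?G"
    by (simp add: one_homotopy_group spheroid_const[OF x])
  fix A assume "A \<in> carrier ?G"
  then obtain f where f: "spheroid n X x f" "A = spheroid_class n X x f"
    by (rule homotopy_groupE)
  show "\<one>\<^bsub>?G\<^esub> \<otimes>\<^bsub>?G\<^esub> A = A"
    using spheroid_class_eqI[OF spheroid_concat_const_left[OF n f(1)]]
    by (simp add: f one_homotopy_group spheroid_const[OF x])
  show "\<exists>B\<in>carrier ?G. B \<otimes>\<^bsub>?G\<^esub> A = \<one>\<^bsub>?G\<^esub>"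
    using l_inv_homotopy_group[OF n f(1)] spheroid_class_in_carrier[OF spheroid_reverse[OF n f(1)]]
    unfolding f(2) by (rule bexI)
  fix B assume "B \<in> carrier ?G"
  then obtain g where g: "spheroid n X x g" "B = spheroid_class n X x g"
    by (rule homotopy_groupE)
  show "A \<otimes>\<^bsub>?G\<^esub> B \<in> carrier ?G"
    by (simp add: f g)
  fix C assume "C \<in> carrier ?G"
  then obtain h where h: "spheroid n X x h" "C = spheroid_class n X x h"
    by (rule homotopy_groupE)
  show "A \<otimes>\<^bsub>?G\<^esub> B \<otimes>\<^bsub>?G\<^esub> C = A \<otimes>\<^bsub>?G\<^esub> (B \<otimes>\<^bsub>?G\<^esub> C)"
    using spheroid_class_eqI[OF spheroid_concat_assoc[OF n f(1) g(1) h(1)]] by (simp add: f g h)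
qed

lemma inv_homotopy_group:
  assumes n: "n \<ge> 1" and f: "spheroid n X x f"
  shows "inv\<^bsub>homotopy_group n X x\<^esub> (spheroid_class n X x f) = spheroid_class n X x (spheroid_reverse f)"
  by (rule group.inv_equality[OF group_homotopy_group[OF n spheroid_base[OF f n]] l_inv_homotopy_group[OF assms]])
    (simp_all add: spheroid_class_in_carrier f spheroid_reverse[OF n f])

lemma homotopy_induced_class:
  assumes f: "spheroid n X x f" and "continuous_map X Y \<phi>" "\<phi> x = y"
  shows "homotopy_induced n Y y \<phi> (spheroid_class n X x f) = spheroid_class n Y y (\<phi> \<circ> f)"
proof -
  have "spheroid_class n Y y (\<phi> \<circ> f') = spheroid_class n Y y (\<phi> \<circ> f)" if "f' \<in> spheroid_class n X x f" for f'
  proof -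
    have "spheroid_homotopic n X x f f'"
      using that by (simp add: spheroid_class_def)
    then show ?thesis
      by (rule spheroid_class_eqI[OF spheroid_homotopic_sym[OF spheroid_homotopic_compose[OF _ assms(2,3)]]])
  qed
  then show ?thesis
    unfolding homotopy_induced_def by (rule UN_eqI[OF spheroid_in_class[OF f]])
qed

section \<open>Images of homotopy groups under a based map\<close>

definition based_map :: "'a topology \<Rightarrow> 'a \<Rightarrow> 'b topology \<Rightarrow> 'b \<Rightarrow> ('a \<Rightarrow> 'b) \<Rightarrow> bool" where
  "based_map A a B b \<omega> \<longleftrightarrow> a \<in> topspace A \<and> continuous_map A B \<omega> \<and> \<omega> a = b"

text \<open>The image of \<open>\<pi>\<^sub>n A\<close> in \<open>\<pi>\<^sub>n B\<close>. Gottlieb groups are the case of the evaluation map of a space of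
  self-maps; the induction leads to other maps \<open>\<omega>\<close>.\<close>

definition image_group ::
    "nat \<Rightarrow> 'a topology \<Rightarrow> 'a \<Rightarrow> 'b topology \<Rightarrow> 'b \<Rightarrow> ('a \<Rightarrow> 'b) \<Rightarrow> ((nat \<Rightarrow> real) \<Rightarrow> 'b) set monoid" where
  "image_group n A a B b \<omega> =
     (homotopy_group n B b)
       \<lparr>carrier := homotopy_induced n B b \<omega> ` carrier (homotopy_group n A a)\<rparr>"

lemma based_map_base: "based_map A a B b \<omega> \<Longrightarrow> b \<in> topspace B"
  by (auto simp: based_map_def continuous_map_def)

lemma based_map_spheroid: "based_map A a B b \<omega> \<Longrightarrow> spheroid n A a f \<Longrightarrow> spheroid n B b (\<omega> \<circ> f)"
  by (auto simp: based_map_def intro: spheroid_compose)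

lemma based_map_induced:
  "based_map A a B b \<omega> \<Longrightarrow> spheroid n A a f \<Longrightarrow>
    homotopy_induced n B b \<omega> (spheroid_class n A a f) = spheroid_class n B b (\<omega> \<circ> f)"
  by (rule homotopy_induced_class) (auto simp: based_map_def)

lemma based_map_homotopic:
  "based_map A a B b \<omega> \<Longrightarrow> spheroid_homotopic n A a f g \<Longrightarrow> spheroid_homotopic n B b (\<omega> \<circ> f) (\<omega> \<circ> g)"
  by (rule spheroid_homotopic_compose) (auto simp: based_map_def)

lemma comp_spheroid_concat: "\<omega> \<circ> spheroid_concat f g = spheroid_concat (\<omega> \<circ> f) (\<omega> \<circ> g)"
  by (auto simp: spheroid_concat_def)

lemma comp_spheroid_reverse: "\<omega> \<circ> spheroid_reverse f = spheroid_reverse (\<omega> \<circ> f)"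
  by (auto simp: spheroid_reverse_def)

lemma image_groupE:
  assumes "based_map A a B b \<omega>" "x \<in> carrier (image_group n A a B b \<omega>)"
  obtains f where "spheroid n A a f" "x = spheroid_class n B b (\<omega> \<circ> f)"
proof -
  obtain X where X: "X \<in> carrier (homotopy_group n A a)" and x: "x = homotopy_induced n B b \<omega> X"
    using assms(2) by (auto simp: image_group_def)
  obtain f where f: "spheroid n A a f" "X = spheroid_class n A a f"
    using X by (rule homotopy_groupE)
  show ?thesis
    using that[OF f(1)] by (simp add: x f(2) based_map_induced[OF assms(1) f(1)])
qed

lemma image_groupI:
  assumes "based_map A a B b \<omega>" "spheroid n A a f"
  shows "spheroid_class n B b (\<omega> \<circ> f) \<in> carrier (image_group n A a B b \<omega>)"
  using imageI[OF spheroid_class_in_carrier[OF assms(2)], of "homotopy_induced n B b \<omega>"]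
  by (simp add: image_group_def based_map_induced[OF assms])

lemma mult_image_group [simp]: "(\<otimes>\<^bsub>image_group n A a B b \<omega>\<^esub>) = (\<otimes>\<^bsub>homotopy_group n B b\<^esub>)"
  and one_image_group [simp]: "\<one>\<^bsub>image_group n A a B b \<omega>\<^esub> = \<one>\<^bsub>homotopy_group n B b\<^esub>"
  by (simp_all add: image_group_def)

lemma group_image_group:
  assumes n: "n \<ge> 1" and \<omega>: "based_map A a B b \<omega>"
  shows "group (image_group n A a B b \<omega>)"
proof -
  have "subgroup (carrier (image_group n A a B b \<omega>)) (homotopy_group n B b)"
  proof (rule group.subgroupI)
    show "group (homotopy_group n B b)"
      using group_homotopy_group[OF n based_map_base[OF \<omega>]] .
    show "carrier (image_group n A a B b \<omega>) \<subseteq> carrier (homotopy_group n B b)"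
      by (auto elim!: image_groupE[OF \<omega>] intro!: spheroid_class_in_carrier based_map_spheroid[OF \<omega>])
    have "spheroid n A a (\<lambda>_. a)"
      using \<omega> by (simp add: based_map_def spheroid_const)
    then show "carrier (image_group n A a B b \<omega>) \<noteq> {}"
      using image_groupI[OF \<omega>] by blast
    fix x assume "x \<in> carrier (image_group n A a B b \<omega>)"
    then obtain f where f: "spheroid n A a f" "x = spheroid_class n B b (\<omega> \<circ> f)"
      by (rule image_groupE[OF \<omega>])
    show "inv\<^bsub>homotopy_group n B b\<^esub> x \<in> carrier (image_group n A a B b \<omega>)"
      using image_groupI[OF \<omega> spheroid_reverse[OF n f(1)]]
      by (simp add: f(2) inv_homotopy_group[OF n based_map_spheroid[OF \<omega> f(1)]] comp_spheroid_reverse)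
    fix y assume "y \<in> carrier (image_group n A a B b \<omega>)"
    then obtain g where g: "spheroid n A a g" "y = spheroid_class n B b (\<omega> \<circ> g)"
      by (rule image_groupE[OF \<omega>])
    show "x \<otimes>\<^bsub>homotopy_group n B b\<^esub> y \<in> carrier (image_group n A a B b \<omega>)"
      using image_groupI[OF \<omega> spheroid_concat[OF n f(1) g(1)]]
      by (simp add: f(2) g(2) mult_homotopy_group[OF n based_map_spheroid[OF \<omega> f(1)] based_map_spheroid[OF \<omega> g(1)]]
          comp_spheroid_concat)
  qed
  from subgroup.subgroup_is_group[OF this group_homotopy_group[OF n based_map_base[OF \<omega>]]]
  show ?thesis
    by (simp add: image_group_def)
qed

lemma mult_image_group_class:
  assumes n: "n \<ge> 1" and \<omega>: "based_map A a B b \<omega>" and f: "spheroid n A a f" and g: "spheroid n A a g"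
  shows "spheroid_class n B b (\<omega> \<circ> f) \<otimes>\<^bsub>homotopy_group n B b\<^esub> spheroid_class n B b (\<omega> \<circ> g)
       = spheroid_class n B b (\<omega> \<circ> spheroid_concat f g)"
  by (simp add: mult_homotopy_group[OF n based_map_spheroid[OF \<omega> f] based_map_spheroid[OF \<omega> g]] comp_spheroid_concat)

lemma spheroid_in_topspace: "spheroid n X x f \<Longrightarrow> p \<in> topspace (cube n) \<Longrightarrow> f p \<in> topspace X"
  by (auto simp: spheroid_def continuous_map_def)

lemma induced_image_class:
  assumes \<omega>: "based_map A a B b \<omega>" and h: "based_map B b B' b' h" and f: "spheroid n A a f"
    and eu: "\<And>x. x \<in> topspace A \<Longrightarrow> \<omega>' (u x) = h (\<omega> x)"
  shows "homotopy_induced n B' b' h (spheroid_class n B b (\<omega> \<circ> f)) = spheroid_class n B' b' (\<omega>' \<circ> (u \<circ> f))"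
  unfolding based_map_induced[OF h based_map_spheroid[OF \<omega> f]]
  by (intro spheroid_class_eqI spheroid_homotopic_eq based_map_spheroid[OF h] based_map_spheroid[OF \<omega>] f)
    (simp add: eu spheroid_in_topspace[OF f])

lemma induced_hom_image_group:
  assumes n: "n \<ge> 1" and \<omega>: "based_map A a B b \<omega>" and \<omega>': "based_map A' a' B' b' \<omega>'"
    and h: "based_map B b B' b' h" and u: "based_map A a A' a' u"
    and eu: "\<And>x. x \<in> topspace A \<Longrightarrow> \<omega>' (u x) = h (\<omega> x)"
  shows "homotopy_induced n B' b' h \<in> hom (image_group n A a B b \<omega>) (image_group n A' a' B' b' \<omega>')"
proof (rule homI)
  let ?G = "image_group n A a B b \<omega>" and ?H = "image_group n A' a' B' b' \<omega>'"
  let ?h = "homotopy_induced n B' b' h"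
  have h_class: "?h (spheroid_class n B b (\<omega> \<circ> f)) = spheroid_class n B' b' (\<omega>' \<circ> (u \<circ> f))"
    if "spheroid n A a f" for f
    using \<omega> h that eu by (rule induced_image_class)
  fix x assume "x \<in> carrier ?G"
  then obtain f where f: "spheroid n A a f" "x = spheroid_class n B b (\<omega> \<circ> f)"
    by (rule image_groupE[OF \<omega>])
  show "?h x \<in> carrier ?H"
    unfolding f(2) h_class[OF f(1)] by (intro image_groupI \<omega>' based_map_spheroid[OF u] f(1))
  fix y assume "y \<in> carrier ?G"
  then obtain g where g: "spheroid n A a g" "y = spheroid_class n B b (\<omega> \<circ> g)"
    by (rule image_groupE[OF \<omega>])
  show "?h (x \<otimes>\<^bsub>?G\<^esub> y) = ?h x \<otimes>\<^bsub>?H\<^esub> ?h y"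
    by (simp only: f(2) g(2) mult_image_group h_class[OF f(1)] h_class[OF g(1)]
        h_class[OF spheroid_concat[OF n f(1) g(1)]] mult_image_group_class[OF n \<omega> f(1) g(1)]
        mult_image_group_class[OF n \<omega>' based_map_spheroid[OF u f(1)] based_map_spheroid[OF u g(1)]]
        comp_spheroid_concat[of u f g])
qed

text \<open>Changing the target by a homeomorphism and exchanging the sources by maps in both directions over
  it leaves the image unchanged: \<open>u\<close> and \<open>v\<close> give one inclusion between the two images each.\<close>

lemma image_group_iso:
  assumes n: "n \<ge> 1" and \<omega>: "based_map A a B b \<omega>" and \<omega>': "based_map A' a' B' b' \<omega>'"
    and hk: "homeomorphic_maps B B' h k" and hb: "h b = b'"
    and u: "based_map A a A' a' u" and v: "based_map A' a' A a v"
    and eu: "\<And>x. x \<in> topspace A \<Longrightarrow> \<omega>' (u x) = h (\<omega> x)"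
    and ev: "\<And>x. x \<in> topspace A' \<Longrightarrow> \<omega>' x = h (\<omega> (v x))"
  shows "image_group n A a B b \<omega> \<cong> image_group n A' a' B' b' \<omega>'"
proof -
  let ?G = "image_group n A a B b \<omega>" and ?H = "image_group n A' a' B' b' \<omega>'"
  let ?h = "homotopy_induced n B' b' h"
  have bB: "b \<in> topspace B"
    by (rule based_map_base[OF \<omega>])
  have h: "based_map B b B' b' h" and kh: "\<And>x. x \<in> topspace B \<Longrightarrow> k (h x) = x"
    using hk hb bB by (auto simp: based_map_def homeomorphic_maps_def)
  have k: "based_map B' b' B b k"
    using hk hb bB based_map_base[OF h] kh by (auto simp: based_map_def homeomorphic_maps_def)
  have hom: "?h \<in> hom ?G ?H"
    by (rule induced_hom_image_group[OF n \<omega> \<omega>' h u eu])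
  have "?h \<in> iso ?G ?H"
  proof (rule isoI[OF hom])
    show "bij_betw ?h (carrier ?G) (carrier ?H)"
      unfolding bij_betw_def
    proof
      have "homotopy_induced n B b k (?h x) = x" if x: "x \<in> carrier ?G" for x
      proof -
        obtain f where f: "spheroid n A a f" "x = spheroid_class n B b (\<omega> \<circ> f)"
          using x by (rule image_groupE[OF \<omega>])
        note s = based_map_spheroid[OF \<omega> f(1)]
        have "homotopy_induced n B b k (?h x) = spheroid_class n B b (k \<circ> (h \<circ> (\<omega> \<circ> f)))"
          by (simp only: f(2) based_map_induced[OF h s] based_map_induced[OF k based_map_spheroid[OF h s]])
        also have "\<dots> = x"
          unfolding f(2)
          by (intro spheroid_class_eqI spheroid_homotopic_eq based_map_spheroid[OF k] based_map_spheroid[OF h] s)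
            (use spheroid_in_topspace[OF s] in \<open>simp add: kh\<close>)
        finally show ?thesis .
      qed
      then show "inj_on ?h (carrier ?G)"
        by (rule inj_on_inverseI)
      show "?h ` carrier ?G = carrier ?H"
      proof
        show "?h ` carrier ?G \<subseteq> carrier ?H"
          using hom by (auto simp: hom_def)
        show "carrier ?H \<subseteq> ?h ` carrier ?G"
        proof
          fix x assume "x \<in> carrier ?H"
          then obtain f where f: "spheroid n A' a' f" "x = spheroid_class n B' b' (\<omega>' \<circ> f)"
            by (rule image_groupE[OF \<omega>'])
          note s = based_map_spheroid[OF v f(1)]
          have "x = ?h (spheroid_class n B b (\<omega> \<circ> (v \<circ> f)))"
            unfolding f(2) based_map_induced[OF h based_map_spheroid[OF \<omega> s]]
            by (intro spheroid_class_eqI spheroid_homotopic_eq based_map_spheroid[OF \<omega>'] f(1))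
              (simp add: ev spheroid_in_topspace[OF f(1)])
          then show "x \<in> ?h ` carrier ?G"
            using image_groupI[OF \<omega> s] by (rule image_eqI)
        qed
      qed
    qed
  qed
  then show ?thesis
    by (rule is_isoI)
qed

lemma spheroid_homotopic_pair:
  assumes \<mu>: "continuous_map (prod_topology A A') B (\<lambda>q. \<mu> (fst q) (snd q))" and "\<mu> a a' = b"
    and f: "spheroid_homotopic n A a f f'" and g: "spheroid_homotopic n A' a' g g'"
  shows "spheroid_homotopic n B b (\<lambda>p. \<mu> (f p) (g p)) (\<lambda>p. \<mu> (f' p) (g' p))"
proof -
  obtain H where H: "continuous_map (prod_topology unit_interval (cube n)) A (\<lambda>q. H (fst q) (snd q))"
    "\<And>p. H 0 p = f p" "\<And>p. H 1 p = f' p"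
    "\<And>t p. 0 \<le> t \<Longrightarrow> t \<le> 1 \<Longrightarrow> p \<in> cube_boundary n \<Longrightarrow> H t p = a"
    using f by (rule spheroid_homotopicE) blast
  obtain K where K: "continuous_map (prod_topology unit_interval (cube n)) A' (\<lambda>q. K (fst q) (snd q))"
    "\<And>p. K 0 p = g p" "\<And>p. K 1 p = g' p"
    "\<And>t p. 0 \<le> t \<Longrightarrow> t \<le> 1 \<Longrightarrow> p \<in> cube_boundary n \<Longrightarrow> K t p = a'"
    using g by (rule spheroid_homotopicE) blast
  show ?thesis
  proof (rule spheroid_homotopicI)
    show "continuous_map (prod_topology unit_interval (cube n)) B (\<lambda>q. \<mu> (H (fst q) (snd q)) (K (fst q) (snd q)))"
      by (rule continuous_map_compose2[OF \<mu> H(1) K(1)])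
  qed (simp_all add: H K assms(2))
qed

text \<open>A pairing \<open>\<mu> : A \<times> A \<rightarrow> B\<close> equal to \<open>\<omega>\<close> on both axes forces commutativity. Once \<open>f\<close> and \<open>g\<close> are
  padded with constants so that they are active on opposite halves of the cube, \<open>\<mu>(f, g)\<close> becomes the concatenation
  of \<open>\<omega> f\<close> and \<open>\<omega> g\<close> in either order, according to which half is given to \<open>f\<close>.\<close>

lemma comm_group_image_group:
  assumes n: "n \<ge> 1" and \<omega>: "based_map A a B b \<omega>"
    and \<mu>: "continuous_map (prod_topology A A) B (\<lambda>q. \<mu> (fst q) (snd q))"
    and unit: "\<And>x. x \<in> topspace A \<Longrightarrow> \<mu> x a = \<omega> x" "\<And>x. x \<in> topspace A \<Longrightarrow> \<mu> a x = \<omega> x"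
  shows "comm_group (image_group n A a B b \<omega>)"
proof (rule group.group_comm_groupI[OF group_image_group[OF n \<omega>]])
  let ?G = "image_group n A a B b \<omega>"
  have a: "a \<in> topspace A" and ab: "\<mu> a a = b"
    using \<omega> unit by (auto simp: based_map_def)
  fix x y assume "x \<in> carrier ?G" "y \<in> carrier ?G"
  then obtain f g where f: "spheroid n A a f" "x = spheroid_class n B b (\<omega> \<circ> f)"
    and g: "spheroid n A a g" "y = spheroid_class n B b (\<omega> \<circ> g)"
    using image_groupE[OF \<omega>] by metis
  have inA: "f (p(0 := u)) \<in> topspace A" "g (p(0 := u)) \<in> topspace A"
    if "p \<in> topspace (cube n)" "0 \<le> u" "u \<le> 1" for p u
    using f(1) g(1) cube_upd[OF that(1) _ that(2,3), of 0] n by (auto simp: spheroid_def continuous_map_def)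
  have "spheroid_homotopic n B b (\<omega> \<circ> spheroid_concat f g) (\<lambda>p. \<mu> (f p) (g p))"
  proof -
    have "spheroid_homotopic n B b (\<omega> \<circ> spheroid_concat f g)
        (\<lambda>p. \<mu> (spheroid_concat f (\<lambda>_. a) p) (spheroid_concat (\<lambda>_. a) g p))"
      by (rule spheroid_homotopic_eq[OF based_map_spheroid[OF \<omega> spheroid_concat[OF n f(1) g(1)]]])
        (use n cube_coord[of _ n 0] in \<open>auto simp: spheroid_concat_def unit inA\<close>)
    also have "spheroid_homotopic n B b \<dots> (\<lambda>p. \<mu> (f p) (g p))"
      by (intro spheroid_homotopic_pair[OF \<mu> ab] spheroid_concat_const_left spheroid_concat_const_right n f g)
    finally show ?thesis .
  qed
  moreover have "spheroid_homotopic n B b (\<omega> \<circ> spheroid_concat g f) (\<lambda>p. \<mu> (f p) (g p))"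
  proof -
    have "spheroid_homotopic n B b (\<omega> \<circ> spheroid_concat g f)
        (\<lambda>p. \<mu> (spheroid_concat (\<lambda>_. a) f p) (spheroid_concat g (\<lambda>_. a) p))"
      by (rule spheroid_homotopic_eq[OF based_map_spheroid[OF \<omega> spheroid_concat[OF n g(1) f(1)]]])
        (use n cube_coord[of _ n 0] in \<open>auto simp: spheroid_concat_def unit inA\<close>)
    also have "spheroid_homotopic n B b \<dots> (\<lambda>p. \<mu> (f p) (g p))"
      by (intro spheroid_homotopic_pair[OF \<mu> ab] spheroid_concat_const_left spheroid_concat_const_right n f g)
    finally show ?thesis .
  qed
  ultimately show "x \<otimes>\<^bsub>?G\<^esub> y = y \<otimes>\<^bsub>?G\<^esub> x"
    unfolding f(2) g(2) mult_image_group mult_image_group_class[OF n \<omega> f(1) g(1)] mult_image_group_class[OF n \<omega> g(1) f(1)]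
    by (intro spheroid_class_eqI) (rule spheroid_homotopic_trans[OF _ spheroid_homotopic_sym])
qed

section \<open>Free loops as closed paths\<close>

text \<open>The inverse of \<open>t \<mapsto> cis (2 * pi * t)\<close> on \<open>[0, 1)\<close>. It is discontinuous at \<open>1\<close>, which is why loops
  are obtained from closed paths by passing to a quotient.\<close>

definition turn :: "complex \<Rightarrow> real" where
  "turn z = Arg2pi z / (2 * pi)"

lemma turn_bounds: "0 \<le> turn z" "turn z < 1" "turn z \<le> 1"
  using Arg2pi_ge_0[of z] Arg2pi_lt_2pi[of z] by (auto simp: turn_def)

lemma cis_turn: "z \<in> topspace circle \<Longrightarrow> cis (2 * pi * turn z) = z"
  using complex_norm_eq_1_exp[of z] by (simp add: turn_def cis_conv_exp)

lemma turn_cis: "0 \<le> t \<Longrightarrow> t < 1 \<Longrightarrow> turn (cis (2 * pi * t)) = t"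
  unfolding turn_def
  by (subst Arg2pi_unique[of 1 "2 * pi * t"]) (auto simp: cis_conv_exp)

lemma turn_1: "turn 1 = 0"
  using turn_cis[of 0] by simp

lemma continuous_map_cis:
  assumes "continuous_map P euclideanreal u"
  shows "continuous_map P circle (\<lambda>x. cis (2 * pi * u x))"
proof -
  have "continuous_map euclideanreal circle (\<lambda>t. cis (2 * pi * t))"
    by (auto simp: continuous_map_in_subtopology intro!: continuous_intros)
  from continuous_map_compose1[OF this assms] show ?thesis .
qed

lemma locally_compact_circle: "locally_compact_space circle"
  and Hausdorff_circle: "Hausdorff_space circle"
  and path_connected_circle: "path_connected_space circle"
proof -
  show "locally_compact_space circle"
    by (intro compact_imp_locally_compact_space) (simp add: compact_space_subtopology)
  show "Hausdorff_space circle"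
    by (simp add: Hausdorff_space_subtopology)
  have "path_connected (sphere (0::complex) 1)"
    by (rule path_connected_sphere) simp
  then show "path_connected_space circle"
    by simp
qed

text \<open>For compact Hausdorff \<open>P\<close> the map \<open>P \<times> [0, 1] \<rightarrow> P \<times> S\<^sup>1\<close> that closes up the interval is a continuous
  surjection from a compact to a Hausdorff space, hence a quotient map.\<close>

lemma continuous_map_close_up:
  assumes P: "compact_space P" "Hausdorff_space P"
    and G: "continuous_map (prod_topology P unit_interval) B (\<lambda>q. G (fst q) (snd q))"
    and closed: "\<And>p. p \<in> topspace P \<Longrightarrow> G p 0 = G p 1"
  shows "continuous_map (prod_topology P circle) B (\<lambda>q. G (fst q) (turn (snd q)))"
proof (rule continuous_compose_quotient_map)
  let ?e = "\<lambda>q. (fst q, cis (2 * pi * snd q))"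
  let ?Q = "prod_topology P unit_interval"
  have e: "continuous_map ?Q (prod_topology P circle) ?e"
    by (intro continuous_map_pairedI continuous_map_cis continuous_map_fst
        continuous_map_from_interval[OF continuous_map_snd])
  show "quotient_map ?Q (prod_topology P circle) ?e"
  proof (rule continuous_imp_quotient_map[OF e])
    show "compact_space ?Q"
      by (simp add: compact_space_prod_topology P compact_space_subtopology)
    show "Hausdorff_space (prod_topology P circle)"
      by (simp add: Hausdorff_space_prod_topology P Hausdorff_circle)
    show "?e ` topspace ?Q = topspace (prod_topology P circle)"
    proof (intro equalityI subsetI)
      fix q assume q: "q \<in> topspace (prod_topology P circle)"
      have "q = ?e (fst q, turn (snd q))"
        using q by (auto simp: cis_turn)
      moreover have "(fst q, turn (snd q)) \<in> topspace ?Q"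
        using q turn_bounds by auto
      ultimately show "q \<in> ?e ` topspace ?Q"
        by (rule image_eqI)
    qed auto
  qed
  show "continuous_map ?Q B ((\<lambda>q. G (fst q) (turn (snd q))) \<circ> ?e)"
  proof (rule continuous_map_eq[OF G])
    fix q assume q: "q \<in> topspace ?Q"
    show "G (fst q) (snd q) = ((\<lambda>q. G (fst q) (turn (snd q))) \<circ> ?e) q"
    proof (cases "snd q < 1")
      case True
      then show ?thesis
        using q by (auto simp: turn_cis)
    next
      case False
      then have "snd q = 1"
        using q by auto
      then show ?thesis
        using q closed[of "fst q"] by (auto simp: turn_1)
    qed
  qed
qed

definition loop_of :: "(real \<Rightarrow> 'a) \<Rightarrow> complex \<Rightarrow> 'a" where
  "loop_of g = (\<lambda>z\<in>topspace circle. g (turn z))"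

definition map_loop :: "('a \<Rightarrow> 'b) \<Rightarrow> (complex \<Rightarrow> 'a) \<Rightarrow> complex \<Rightarrow> 'b" where
  "map_loop \<omega> \<gamma> = (\<lambda>z\<in>topspace circle. \<omega> (\<gamma> z))"

lemma loop_of_const: "(\<And>t. 0 \<le> t \<Longrightarrow> t \<le> 1 \<Longrightarrow> g t = b) \<Longrightarrow> loop_of g = const_loop b"
  by (auto simp: loop_of_def const_loop_def turn_bounds)

lemma const_loop_apply [simp]: "z \<in> topspace circle \<Longrightarrow> const_loop b z = b"
  by (simp add: const_loop_def)

lemma const_loop_extensional: "const_loop b \<in> extensional (topspace circle)"
  by (simp add: const_loop_def)

lemma free_loop_extensional:
  "\<gamma> \<in> topspace (free_loop_space B b) \<Longrightarrow> \<gamma> \<in> extensional (topspace circle)"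
  using mem_mapping_componentD[of \<gamma> circle B "const_loop b"] unfolding free_loop_space_def by blast

lemma free_loop_in_topspace:
  "\<gamma> \<in> topspace (free_loop_space B b) \<Longrightarrow> z \<in> topspace circle \<Longrightarrow> \<gamma> z \<in> topspace B"
  using mem_mapping_componentD[of \<gamma> circle B "const_loop b"]
  unfolding free_loop_space_def continuous_map_def by blast

lemma map_loop_const: "map_loop \<omega> (const_loop a) = const_loop (\<omega> a)"
  by (auto simp: map_loop_def const_loop_def)

lemma map_loop_loop_of: "map_loop \<omega> (loop_of g) = loop_of (\<omega> \<circ> g)"
  by (auto simp: map_loop_def loop_of_def)

lemma const_loop_in_free_loop_space:
  "b \<in> topspace B \<Longrightarrow> const_loop b \<in> topspace (free_loop_space B b)"
  unfolding free_loop_space_def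
proof (rule base_in_mapping_component[OF _ const_loop_extensional])
  assume "b \<in> topspace B"
  then have "continuous_map circle B (\<lambda>_. b)"
    by simp
  then show "continuous_map circle B (const_loop b)"
    by (rule continuous_map_eq) (simp add: const_loop_def)
qed

lemma path_connected_free_loop_space: "path_connected_space (free_loop_space B b)"
  unfolding free_loop_space_def by (rule path_connected_space_mapping_component)

lemma continuous_map_free_loop_eval:
  assumes "continuous_map P (free_loop_space B b) g" "continuous_map Q P p" "continuous_map Q circle z"
  shows "continuous_map Q B (\<lambda>x. g (p x) (z x))"
  using continuous_map_uncurry_component[OF locally_compact_circle Hausdorff_circle] assms
  unfolding free_loop_space_def by blast

lemma continuous_map_into_free_loop_space:
  assumes P: "path_connected_space P" "p \<in> topspace P"
    and F: "continuous_map (prod_topology P circle) B (\<lambda>q. F (fst q) (snd q))"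
    and b: "\<And>z. z \<in> topspace circle \<Longrightarrow> F p z = b"
  shows "continuous_map P (free_loop_space B b) (\<lambda>p. \<lambda>z\<in>topspace circle. F p z)"
  using continuous_map_curry_component[OF P F const_loop_extensional, of b] b
  by (simp add: free_loop_space_def)

lemma continuous_map_loop_of:
  assumes P: "path_connected_space P" "p \<in> topspace P" "compact_space P" "Hausdorff_space P"
    and G: "continuous_map (prod_topology P unit_interval) B (\<lambda>q. G (fst q) (snd q))"
    and closed: "\<And>p. p \<in> topspace P \<Longrightarrow> G p 0 = G p 1"
    and b: "\<And>t. 0 \<le> t \<Longrightarrow> t \<le> 1 \<Longrightarrow> G p t = b"
  shows "continuous_map P (free_loop_space B b) (\<lambda>p. loop_of (G p))"
  unfolding loop_of_def
  by (rule continuous_map_into_free_loop_space[OF P(1,2) continuous_map_close_up[OF P(3,4) G closed]])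
    (simp_all add: b turn_bounds)

lemma based_map_const_loop:
  assumes B: "path_connected_space B" "b \<in> topspace B"
  shows "based_map B b (free_loop_space B b) (const_loop b) const_loop"
  unfolding based_map_def
proof (intro conjI B refl)
  have "continuous_map B (free_loop_space B b) (\<lambda>x. \<lambda>z\<in>topspace circle. x)"
    by (rule continuous_map_into_free_loop_space[OF B]) (simp_all add: continuous_map_fst)
  then show "continuous_map B (free_loop_space B b) const_loop"
    by (simp add: const_loop_def[abs_def])
qed

lemma based_map_eval:
  assumes "b \<in> topspace B"
  shows "based_map (free_loop_space B b) (const_loop b) B b (\<lambda>\<gamma>. \<gamma> 1)"
  unfolding based_map_def
proof (intro conjI const_loop_in_free_loop_space assms)
  show "continuous_map (free_loop_space B b) B (\<lambda>\<gamma>. \<gamma> 1)"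
    by (rule continuous_map_free_loop_eval[where g = "\<lambda>x. x" and p = "\<lambda>x. x" and z = "\<lambda>_. 1"
          and P = "free_loop_space B b" and b = b])
      (simp_all add: continuous_map_id[unfolded id_def])
qed simp

lemma based_map_map_loop:
  assumes \<omega>: "based_map A a B b \<omega>"
  shows "based_map (free_loop_space A a) (const_loop a) (free_loop_space B b) (const_loop b) (map_loop \<omega>)"
  unfolding based_map_def
proof (intro conjI const_loop_in_free_loop_space)
  show a: "a \<in> topspace A"
    using \<omega> by (simp add: based_map_def)
  show "map_loop \<omega> (const_loop a) = const_loop b"
    using \<omega> by (simp add: based_map_def map_loop_const)
  let ?P = "free_loop_space A a"
  have "continuous_map (prod_topology ?P circle) A (\<lambda>q. fst q (snd q))"
    by (rule continuous_map_free_loop_eval[where g = "\<lambda>x. x" and p = fst and z = snd and P = ?P and b = a])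
      (simp_all add: continuous_map_id[unfolded id_def] continuous_map_fst continuous_map_snd)
  moreover have "continuous_map A B \<omega>"
    using \<omega> by (simp add: based_map_def)
  ultimately have "continuous_map (prod_topology ?P circle) B (\<lambda>q. \<omega> (fst q (snd q)))"
    by (rule continuous_map_compose1[where a = "\<lambda>q. fst q (snd q)", rotated])
  then show "continuous_map ?P (free_loop_space B b) (map_loop \<omega>)"
    unfolding map_loop_def[abs_def]
    by (rule continuous_map_into_free_loop_space[OF path_connected_free_loop_space const_loop_in_free_loop_space[OF a]])
      (use \<omega> in \<open>simp add: based_map_def\<close>)
qed

section \<open>Trading the last cube coordinate for a loop\<close>

text \<open>The adjoint of a spheroid in its last coordinate. Concatenation takes place in the coordinate \<open>0\<close>,
  which for \<open>n \<ge> 1\<close> is a different one, so that the adjoint respects it on the nose.\<close>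

definition loop_last :: "nat \<Rightarrow> ((nat \<Rightarrow> real) \<Rightarrow> 'a) \<Rightarrow> (nat \<Rightarrow> real) \<Rightarrow> complex \<Rightarrow> 'a" where
  "loop_last n g s = loop_of (\<lambda>t. g (s(n := t)))"

lemma cube_boundary_extend:
  "s \<in> cube_boundary n \<Longrightarrow> 0 \<le> t \<Longrightarrow> t \<le> 1 \<Longrightarrow> s(n := t) \<in> cube_boundary (Suc n)"
  by (fastforce simp: cube_boundary_def cube_extend)

lemma cube_boundary_last:
  "s \<in> topspace (cube n) \<Longrightarrow> t = 0 \<or> t = 1 \<Longrightarrow> s(n := t) \<in> cube_boundary (Suc n)"
  by (auto simp: cube_boundary_def cube_extend)

lemma cube_boundary_SucE:
  assumes "p \<in> cube_boundary (Suc n)"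
  obtains "p(n := undefined) \<in> cube_boundary n" | "p n = 0 \<or> p n = 1"
proof -
  obtain i where i: "i < Suc n" "p i = 0 \<or> p i = 1" and p: "p \<in> topspace (cube (Suc n))"
    using assms by (auto simp: cube_boundary_def)
  show thesis
  proof (cases "i = n")
    case True
    then show ?thesis
      using i that(2) by blast
  next
    case False
    then have "i < n" "(p(n := undefined)) i = 0 \<or> (p(n := undefined)) i = 1"
      using i by auto
    then show ?thesis
      using that(1) cube_drop[OF p] unfolding cube_boundary_def by blast
  qed
qed

lemma continuous_map_fst_fst: "continuous_map (prod_topology (prod_topology X Y) Z) X (\<lambda>q. fst (fst q))"
  by (rule continuous_map_compose1[OF continuous_map_fst continuous_map_fst])

lemma continuous_map_snd_fst: "continuous_map (prod_topology (prod_topology X Y) Z) Y (\<lambda>q. snd (fst q))"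
  by (rule continuous_map_compose1[OF continuous_map_snd continuous_map_fst])

lemma interval_times_cube:
  shows "path_connected_space (prod_topology unit_interval (cube n))"
    and "compact_space (prod_topology unit_interval (cube n))"
    and "Hausdorff_space (prod_topology unit_interval (cube n))"
proof -
  have "path_connected {0..1::real}"
    by (simp add: is_interval_path_connected)
  then show "path_connected_space (prod_topology unit_interval (cube n))"
    by (simp add: path_connected_space_prod_topology path_connected_cube)
qed (simp_all add: compact_space_prod_topology compact_cube compact_space_subtopology
      Hausdorff_space_prod_topology Hausdorff_cube Hausdorff_space_subtopology)

lemma spheroid_homotopic_loop_last:
  assumes n: "n \<ge> 1" and f: "spheroid_homotopic (Suc n) B b f g"
  shows "spheroid_homotopic n (free_loop_space B b) (const_loop b) (loop_last n f) (loop_last n g)"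
proof -
  obtain H where H: "continuous_map (prod_topology unit_interval (cube (Suc n))) B (\<lambda>q. H (fst q) (snd q))"
    "\<And>p. H 0 p = f p" "\<And>p. H 1 p = g p"
    "\<And>t p. 0 \<le> t \<Longrightarrow> t \<le> 1 \<Longrightarrow> p \<in> cube_boundary (Suc n) \<Longrightarrow> H t p = b"
    using f by (rule spheroid_homotopicE) blast
  obtain s where s: "s \<in> cube_boundary n"
    using cube_boundary_nonempty[OF n] .
  let ?P = "prod_topology unit_interval (cube n)"
  have "continuous_map ?P (free_loop_space B b) (\<lambda>p. loop_of (\<lambda>t. H (fst p) ((snd p)(n := t))))"
  proof (rule continuous_map_loop_of[where p = "(0, s)", OF interval_times_cube(1) _ interval_times_cube(2,3)])
    show "(0, s) \<in> topspace ?P"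
      using cube_boundary_subset[OF s] by simp
    show "continuous_map (prod_topology ?P unit_interval) B (\<lambda>q. H (fst (fst q)) ((snd (fst q))(n := snd q)))"
      by (rule continuous_map_compose2[OF H(1)])
        (intro continuous_map_fst_fst continuous_map_cube_extend continuous_map_snd_fst continuous_map_snd)+
  qed (use s in \<open>auto simp: H(4) cube_boundary_extend cube_boundary_last\<close>)
  then show ?thesis
    by (rule spheroid_homotopicI[where H = "\<lambda>r s. loop_of (\<lambda>t. H r (s(n := t)))"])
      (auto simp: H(2,3) loop_last_def H(4) cube_boundary_extend intro!: loop_of_const)
qed

lemma spheroid_loop_last:
  assumes "n \<ge> 1" "spheroid (Suc n) B b f"
  shows "spheroid n (free_loop_space B b) (const_loop b) (loop_last n f)"
  by (rule spheroid_homotopic_imp_spheroid(1)[OF spheroid_homotopic_loop_last[OF assms(1) spheroid_homotopic_refl[OF assms(2)]]])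

lemma loop_last_concat:
  assumes "n \<ge> 1"
  shows "loop_last n (spheroid_concat f g) = spheroid_concat (loop_last n f) (loop_last n g)"
proof
  fix s :: "nat \<Rightarrow> real"
  have "(s(n := t))(0 := u) = (s(0 := u))(n := t)" for t u
    using assms by (simp add: fun_upd_twist)
  then show "loop_last n (spheroid_concat f g) s = spheroid_concat (loop_last n f) (loop_last n g) s"
    using assms by (simp add: loop_last_def spheroid_concat_def)
qed

lemma map_loop_loop_last: "map_loop \<omega> (loop_last n g s) = loop_last n (\<omega> \<circ> g) s"
  by (simp add: loop_last_def map_loop_loop_of comp_def)

lemma loop_last_cis:
  assumes "spheroid (Suc n) B b g" "s \<in> topspace (cube n)" "0 \<le> t" "t \<le> 1"
  shows "loop_last n g s (cis (2 * pi * t)) = g (s(n := t))"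
proof (cases "t < 1")
  case True
  then show ?thesis
    using assms by (simp add: loop_last_def loop_of_def turn_cis)
next
  case False
  then have "t = 1" using assms by simp
  then show ?thesis
    using spheroid_boundary[OF assms(1) cube_boundary_last[OF assms(2)]]
    by (simp add: loop_last_def loop_of_def turn_1)
qed

text \<open>Injectivity of \<open>\<pi>\<^sub>n\<^sub>+\<^sub>1 B \<rightarrow> \<pi>\<^sub>n \<Lambda>B\<close>. A null homotopy through free loops may move the base point of the
  loops along a track. For fixed \<open>s\<close> it is a square with coordinates \<open>(r, t)\<close>, whose bottom edge is the loop
  \<open>g(s, t)\<close>, whose left and right edges are both the track, and whose top edge is constant. Pushing the
  bottom edge across the square onto the other three edges deforms \<open>g\<close>, with fixed end points, into the
  track followed by its reverse, which is then retracted.\<close>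

lemma null_homotopic_of_loop_last:
  assumes n: "n \<ge> 1" and g: "spheroid (Suc n) B b g"
    and null: "spheroid_homotopic n (free_loop_space B b) (const_loop b) (loop_last n g) (\<lambda>_. const_loop b)"
  shows "spheroid_homotopic (Suc n) B b g (\<lambda>_. b)"
proof -
  obtain H where H: "continuous_map (prod_topology unit_interval (cube n)) (free_loop_space B b) (\<lambda>q. H (fst q) (snd q))"
    "\<And>p. H 0 p = loop_last n g p" "\<And>p. H 1 p = const_loop b"
    "\<And>t p. 0 \<le> t \<Longrightarrow> t \<le> 1 \<Longrightarrow> p \<in> cube_boundary n \<Longrightarrow> H t p = const_loop b"
    using null by (rule spheroid_homotopicE) blast
  define W where "W = (\<lambda>r s t. H r s (cis (2 * pi * t)))"
  have W: "continuous_map Q B (\<lambda>q. W (r q) (s q) (t q))"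
    if "continuous_map Q unit_interval r" "continuous_map Q (cube n) s" "continuous_map Q euclideanreal t"
    for Q :: "(real \<times> (nat \<Rightarrow> real)) topology" and r s t
  proof -
    have "continuous_map Q (prod_topology unit_interval (cube n)) (\<lambda>q. (r q, s q))"
      using that by (intro continuous_map_pairedI)
    from continuous_map_free_loop_eval[OF H(1) this continuous_map_cis[OF that(3)]] show ?thesis
      by (simp add: W_def)
  qed
  have W0: "W 0 s t = g (s(n := t))" if "s \<in> topspace (cube n)" "0 \<le> t" "t \<le> 1" for s t
    using loop_last_cis[OF g that] by (simp add: W_def H(2))
  have W1: "W 1 s t = b" for s t
    by (simp add: W_def H(3))
  have Wb: "W r s t = b" if "s \<in> cube_boundary n" "0 \<le> r" "r \<le> 1" for r s t
    using H(4)[OF that(2,3,1)] by (simp add: W_def)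
  have Wend: "W r s 1 = W r s 0" for r s
    by (simp add: W_def)
  have drop: "(p(n := undefined))(n := p n) = p" for p :: "nat \<Rightarrow> real"
    by simp
  \<comment> \<open>The path \<open>t \<mapsto> (m t, c t)\<close> runs along the left, top and right edges of the square, a third of the time on
  each.\<close>
  define m where "m = (\<lambda>t::real. min 1 (min (3 * t) (3 - 3 * t)))"
  define c where "c = (\<lambda>t::real. max 0 (min 1 (3 * t - 1)))"
  have m: "0 \<le> m t" "m t \<le> 1" if "0 \<le> t" "t \<le> 1" for t
    using that by (auto simp: m_def)
  have c: "0 \<le> c t" "c t \<le> 1" for t
    by (auto simp: c_def)
  have m_cont: "continuous_on UNIV m" and c_cont: "continuous_on UNIV c"
    unfolding m_def c_def by (intro continuous_intros)+
  let ?Q = "prod_topology unit_interval (cube (Suc n))"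
  have r0: "continuous_map ?Q euclideanreal fst"
    by (rule continuous_map_from_interval[OF continuous_map_fst])
  have pn: "continuous_map ?Q euclideanreal (\<lambda>q. snd q n)"
    by (rule continuous_map_cube_coord[OF continuous_map_snd]) simp
  have pd: "continuous_map ?Q (cube n) (\<lambda>q. (snd q)(n := undefined))"
    by (rule continuous_map_cube_drop[OF continuous_map_snd])
  note mc = continuous_map_real_compose[OF pn m_cont] and cc = continuous_map_real_compose[OF pn c_cont]
  have pn01: "0 \<le> p n" "p n \<le> 1" if "p \<in> topspace (cube (Suc n))" for p
    using cube_coord[OF that, of n] by auto
  have rm01: "0 \<le> r * m (p n)" "r * m (p n) \<le> 1"
    if "p \<in> topspace (cube (Suc n))" "0 \<le> r" "r \<le> 1" for p r
    using m[OF pn01[OF that(1)]] that(2,3) by (auto intro: mult_le_one)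
  have "spheroid_homotopic (Suc n) B b g (\<lambda>p. W (m (p n)) (p(n := undefined)) 0)"
  proof (rule spheroid_homotopicI[where H = "\<lambda>r p. W (r * m (p n)) (p(n := undefined)) ((1 - r) * p n + r * c (p n))"])
    show "continuous_map ?Q B (\<lambda>q. W (fst q * m (snd q n)) ((snd q)(n := undefined))
        ((1 - fst q) * snd q n + fst q * c (snd q n)))"
      by (intro W pd continuous_map_into_interval continuous_intros r0 pn mc cc)
        (auto simp: rm01)
  next
    fix p assume p: "p \<in> topspace (cube (Suc n))"
    show "W (0 * m (p n)) (p(n := undefined)) ((1 - 0) * p n + 0 * c (p n)) = g p"
      using W0[OF cube_drop[OF p] pn01[OF p]] by simp
    consider "p n \<le> 1/3" | "1/3 < p n" "p n < 2/3" | "2/3 \<le> p n"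
      by linarith
    then have "W (m (p n)) (p(n := undefined)) (c (p n)) = W (m (p n)) (p(n := undefined)) 0"
    proof cases
      case 1
      then have "c (p n) = 0" by (simp add: c_def)
      then show ?thesis by simp
    next
      case 2
      then have "m (p n) = 1" by (simp add: m_def)
      then show ?thesis by (simp add: W1)
    next
      case 3
      then have "c (p n) = 1" by (simp add: c_def)
      then show ?thesis by (simp add: Wend)
    qed
    then show "W (1 * m (p n)) (p(n := undefined)) ((1 - 1) * p n + 1 * c (p n))
        = W (m (p n)) (p(n := undefined)) 0"
      by simp
  next
    fix r p assume r: "0 \<le> r" "r \<le> (1::real)" and p: "p \<in> cube_boundary (Suc n)"
    note pc = cube_boundary_subset[OF p]
    note rm = rm01[OF pc r]
    from p show "W (r * m (p n)) (p(n := undefined)) ((1 - r) * p n + r * c (p n)) = b"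
    proof (cases rule: cube_boundary_SucE)
      case 1
      then show ?thesis by (rule Wb[OF _ rm])
    next
      case 2
      have "W 0 (p(n := undefined)) (p n) = b"
        using W0[OF cube_drop[OF pc] pn01[OF pc]] spheroid_boundary[OF g p] by simp
      moreover have "m (p n) = 0" "(1 - r) * p n + r * c (p n) = p n"
        using 2 by (auto simp: m_def c_def)
      ultimately show ?thesis
        by simp
    qed
  qed
  also have "spheroid_homotopic (Suc n) B b \<dots> (\<lambda>_. b)"
  proof (rule spheroid_homotopicI[where H = "\<lambda>r p. W ((1 - r) * m (p n)) (p(n := undefined)) 0"])
    show "continuous_map ?Q B (\<lambda>q. W ((1 - fst q) * m (snd q n)) ((snd q)(n := undefined)) 0)"
      by (intro W pd continuous_map_into_interval continuous_intros r0 mc)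
        (auto simp: rm01)
  next
    fix p assume p: "p \<in> topspace (cube (Suc n))"
    have "W 0 (p(n := undefined)) 0 = b"
      using W0[OF cube_drop[OF p], of 0] spheroid_boundary[OF g cube_boundary_last[OF cube_drop[OF p], of 0]] by simp
    then show "W ((1 - 1) * m (p n)) (p(n := undefined)) 0 = b"
      by simp
  next
    fix r p assume r: "0 \<le> r" "r \<le> (1::real)" and p: "p \<in> cube_boundary (Suc n)"
    note pc = cube_boundary_subset[OF p]
    have rm: "0 \<le> (1 - r) * m (p n)" "(1 - r) * m (p n) \<le> 1"
      using r rm01[OF pc, of "1 - r"] by auto
    from p show "W ((1 - r) * m (p n)) (p(n := undefined)) 0 = b"
    proof (cases rule: cube_boundary_SucE)
      case 1
      then show ?thesis by (rule Wb[OF _ rm])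
    next
      case 2
      have "W 0 (p(n := undefined)) 0 = b"
        using W0[OF cube_drop[OF pc], of 0] spheroid_boundary[OF g cube_boundary_last[OF cube_drop[OF pc], of 0]] by simp
      moreover have "m (p n) = 0"
        using 2 by (auto simp: m_def)
      ultimately show ?thesis
        by simp
    qed
  qed simp
  finally show ?thesis .
qed

text \<open>Exactness at \<open>\<pi>\<^sub>n \<Lambda>A\<close>. If the base points \<open>K s 1\<close> of the loops contract to \<open>a\<close> along \<open>C\<close>, then \<open>K\<close> is
  deformed into a family of based loops by attaching to each loop the track of its base point under \<open>C\<close> as a tail
  at both ends.\<close>

lemma loop_last_of_null_evaluation:
  assumes n: "n \<ge> 1" and K: "spheroid n (free_loop_space A a) (const_loop a) K"
    and null: "spheroid_homotopic n A a (\<lambda>s. K s 1) (\<lambda>_. a)"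
  obtains g where "spheroid (Suc n) A a g"
    "spheroid_homotopic n (free_loop_space A a) (const_loop a) K (loop_last n g)"
proof -
  obtain C where C: "continuous_map (prod_topology unit_interval (cube n)) A (\<lambda>q. C (fst q) (snd q))"
    "\<And>p. C 0 p = K p 1" "\<And>p. C 1 p = a"
    "\<And>t p. 0 \<le> t \<Longrightarrow> t \<le> 1 \<Longrightarrow> p \<in> cube_boundary n \<Longrightarrow> C t p = a"
    using null by (rule spheroid_homotopicE) blast
  \<comment> \<open>At stage \<open>r\<close> the tails occupy \<open>[0, r/3]\<close> and \<open>[1 - r/3, 1]\<close>, on which \<open>\<rho>\<close> falls from \<open>r\<close> to \<open>0\<close> and
  rises back; \<open>\<tau>\<close> stretches the interval in between to \<open>[0, 1]\<close>.\<close>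
  define \<tau> where "\<tau> = (\<lambda>r t :: real. (t - r / 3) / (1 - 2 * r / 3))"
  define \<rho> where "\<rho> = (\<lambda>r t :: real. max 0 (min 1 ((3 * \<bar>2 * t - 1\<bar> - 3 + 2 * r) / 2)))"
  define G where "G = (\<lambda>r s t. if \<bar>2 * t - 1\<bar> \<le> 1 - 2 * r / 3
      then K s (cis (2 * pi * \<tau> r t)) else C (\<rho> r t) s)"
  have \<rho>: "0 \<le> \<rho> r t" "\<rho> r t \<le> 1" for r t
    by (auto simp: \<rho>_def)
  have Kb: "K s = const_loop a" if "s \<in> cube_boundary n" for s
    by (rule spheroid_boundary[OF K that])
  have Gb: "G r s t = a" if "s \<in> cube_boundary n" for r s t
    using that \<rho> by (simp add: G_def Kb C(4))
  have G0: "G 0 s t = K s (cis (2 * pi * t))" if "0 \<le> t" "t \<le> 1" for s t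
  proof -
    have "\<bar>2 * t - 1\<bar> \<le> 1"
      using that by (auto simp: abs_le_iff)
    then show ?thesis
      by (simp add: G_def \<tau>_def)
  qed
  have Gend: "G r s 0 = G r s 1" if "0 \<le> r" for r s
  proof (cases "r = 0")
    case False
    then have "0 < r" using that by simp
    then show ?thesis
      by (simp add: G_def \<rho>_def)
  qed (simp add: G0)
  have G1: "G 1 s t = a" if "t = 0 \<or> t = 1" for s t
    using that by (auto simp: G_def \<rho>_def C(3))
  have G: "continuous_map Q A (\<lambda>q. G (r q) (s q) (t q))"
    if r: "continuous_map Q unit_interval r" and s: "continuous_map Q (cube n) s"
      and t: "continuous_map Q unit_interval t" for Q :: "'q topology" and r s t
  proof -
    note rR = continuous_map_from_interval[OF r] and tR = continuous_map_from_interval[OF t]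
    have r01: "0 \<le> r q" "r q \<le> 1" if "q \<in> topspace Q" for q
      using r that by (auto simp: continuous_map_in_subtopology image_subset_iff)
    have tau: "continuous_map Q euclideanreal (\<lambda>q. \<tau> (r q) (t q))"
      unfolding \<tau>_def
      by (intro continuous_map_real_divide continuous_intros rR tR) (auto dest: r01(2))
    have rho: "continuous_map Q unit_interval (\<lambda>q. \<rho> (r q) (t q))"
      unfolding \<rho>_def
      by (intro continuous_map_into_interval continuous_map_real_divide continuous_intros rR tR) auto
    show ?thesis
      unfolding G_def
    proof (rule continuous_map_cases_le)
      show "continuous_map Q euclideanreal (\<lambda>q. \<bar>2 * t q - 1\<bar>)"
        by (intro continuous_intros tR)
      show "continuous_map Q euclideanreal (\<lambda>q. 1 - 2 * r q / 3)"
        by (intro continuous_map_real_divide continuous_intros rR) auto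
      show "continuous_map (subtopology Q S) A (\<lambda>q. K (s q) (cis (2 * pi * \<tau> (r q) (t q))))" for S
        by (intro continuous_map_from_subtopology
            continuous_map_free_loop_eval[OF spheroid_continuous[OF K] s continuous_map_cis[OF tau]])
      show "continuous_map (subtopology Q S) A (\<lambda>q. C (\<rho> (r q) (t q)) (s q))" for S
        by (intro continuous_map_from_subtopology continuous_map_compose2[OF C(1) rho s])
      fix q assume q: "q \<in> topspace Q" and eq: "\<bar>2 * t q - 1\<bar> = 1 - 2 * r q / 3"
      have "\<rho> (r q) (t q) = 0"
        by (simp add: \<rho>_def eq)
      moreover have "1 - 2 * r q / 3 \<noteq> 0"
        using r01(2)[OF q] by auto
      then have "\<tau> (r q) (t q) = 0 \<or> \<tau> (r q) (t q) = 1"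
        using eq by (auto simp: \<tau>_def abs_if field_simps split: if_splits)
      ultimately show "K (s q) (cis (2 * pi * \<tau> (r q) (t q))) = C (\<rho> (r q) (t q)) (s q)"
        by (auto simp: C(2))
    qed
  qed
  define g where "g = (\<lambda>p. G 1 (p(n := undefined)) (p n))"
  have gs: "loop_last n g s = loop_of (G 1 s)" if "s \<in> topspace (cube n)" for s
  proof -
    have "s(n := undefined) = s"
      using cube_undefined[OF that] by auto
    then show ?thesis
      by (simp add: loop_last_def g_def)
  qed
  have "continuous_map (cube (Suc n)) A g"
    unfolding g_def
  proof (rule G)
    show "continuous_map (cube (Suc n)) unit_interval (\<lambda>p. p n)"
      using continuous_map_product_projection[of n "{..<Suc n}" "\<lambda>_. unit_interval"] by (simp add: cube_def)
    show "continuous_map (cube (Suc n)) (cube n) (\<lambda>p. p(n := undefined))"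
      using continuous_map_cube_drop[OF continuous_map_id[unfolded id_def]] .
  qed simp
  moreover have "g p = a" if "p \<in> cube_boundary (Suc n)" for p
    using that by (cases rule: cube_boundary_SucE) (auto simp: g_def Gb G1)
  ultimately have "spheroid (Suc n) A a g"
    by (simp add: spheroid_def)
  moreover have "spheroid_homotopic n (free_loop_space A a) (const_loop a) K (loop_last n g)"
  proof (rule spheroid_homotopicI[where H = "\<lambda>r s. loop_of (G r s)"])
    obtain s where s: "s \<in> cube_boundary n"
      using cube_boundary_nonempty[OF n] .
    let ?P = "prod_topology unit_interval (cube n)"
    show "continuous_map ?P (free_loop_space A a) (\<lambda>q. loop_of (G (fst q) (snd q)))"
    proof (rule continuous_map_loop_of[where p = "(0, s)", OF interval_times_cube(1) _ interval_times_cube(2,3)])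
      show "(0, s) \<in> topspace ?P"
        using cube_boundary_subset[OF s] by simp
      show "continuous_map (prod_topology ?P unit_interval) A (\<lambda>q. G (fst (fst q)) (snd (fst q)) (snd q))"
        by (rule G[OF continuous_map_fst_fst continuous_map_snd_fst continuous_map_snd])
    qed (auto simp: Gb[OF s] intro: Gend)
    show "loop_of (G 0 p) = K p" if p: "p \<in> topspace (cube n)" for p
    proof (rule extensionalityI[where A = "topspace circle"])
      show "K p \<in> extensional (topspace circle)"
        by (rule free_loop_extensional[OF spheroid_in_topspace[OF K p]])
    qed (simp_all add: loop_of_def G0 turn_bounds cis_turn)
    show "loop_of (G 1 p) = loop_last n g p" if "p \<in> topspace (cube n)" for p
      by (simp add: gs[OF that])
  qed (simp add: Gb loop_of_const)
  ultimately show ?thesis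
    by (rule that)
qed

section \<open>The splitting for a map of free loop spaces\<close>

text \<open>A split short exact sequence \<open>Q \<rightarrow> R \<rightarrow> P\<close>; commutativity of \<open>R\<close> makes the semidirect product direct.\<close>

lemma split_extension_iso:
  assumes P: "group P" and Q: "group Q" and R: "comm_group R"
    and i: "i \<in> hom P R" and j: "j \<in> hom Q R" and e: "e \<in> hom R P"
    and ei: "\<And>x. x \<in> carrier P \<Longrightarrow> e (i x) = x"
    and ej: "\<And>y. y \<in> carrier Q \<Longrightarrow> e (j y) = \<one>\<^bsub>P\<^esub>"
    and j_inj: "\<And>y. y \<in> carrier Q \<Longrightarrow> j y = \<one>\<^bsub>R\<^esub> \<Longrightarrow> y = \<one>\<^bsub>Q\<^esub>"
    and ker: "\<And>r. r \<in> carrier R \<Longrightarrow> e r = \<one>\<^bsub>P\<^esub> \<Longrightarrow> r \<in> j ` carrier Q"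
  shows "P \<times>\<times> Q \<cong> R"
proof -
  interpret P: group P by fact
  interpret Q: group Q by fact
  interpret R: comm_group R by fact
  interpret i: group_hom P R i by unfold_locales (rule i)
  interpret j: group_hom Q R j by unfold_locales (rule j)
  interpret e: group_hom R P e by unfold_locales (rule e)
  let ?f = "\<lambda>(x, y). i x \<otimes>\<^bsub>R\<^esub> j y"
  have hom: "?f \<in> hom (P \<times>\<times> Q) R"
    by (rule homI) (auto simp: R.m_ac)
  interpret PQ: group "P \<times>\<times> Q"
    by (rule DirProd_group[OF P Q])
  interpret f: group_hom "P \<times>\<times> Q" R ?f
    by unfold_locales (rule hom)
  have inj: "inj_on ?f (carrier (P \<times>\<times> Q))"
    unfolding f.inj_on_one_iff
  proof (intro allI impI, clarsimp)
    fix x y assume x: "x \<in> carrier P" and y: "y \<in> carrier Q" and eq: "i x \<otimes>\<^bsub>R\<^esub> j y = \<one>\<^bsub>R\<^esub>"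
    have "e (i x \<otimes>\<^bsub>R\<^esub> j y) = x"
      using x y by (simp add: ei ej)
    then have x1: "x = \<one>\<^bsub>P\<^esub>"
      by (simp add: eq)
    with eq y have "j y = \<one>\<^bsub>R\<^esub>"
      by simp
    with x1 show "x = \<one>\<^bsub>P\<^esub> \<and> y = \<one>\<^bsub>Q\<^esub>"
      using j_inj[OF y] by simp
  qed
  have "?f ` carrier (P \<times>\<times> Q) = carrier R"
  proof
    show "?f ` carrier (P \<times>\<times> Q) \<subseteq> carrier R"
      by auto
    show "carrier R \<subseteq> ?f ` carrier (P \<times>\<times> Q)"
    proof
      fix r assume r: "r \<in> carrier R"
      let ?s = "inv\<^bsub>R\<^esub> (i (e r)) \<otimes>\<^bsub>R\<^esub> r"
      have "e ?s = \<one>\<^bsub>P\<^esub>"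
        using r by (simp add: ei)
      then obtain y where y: "y \<in> carrier Q" "?s = j y"
        using ker[of ?s] r by auto
      have "r = i (e r) \<otimes>\<^bsub>R\<^esub> ?s"
        using r by (simp flip: R.m_assoc)
      then have "r = ?f (e r, y)"
        using y(2) by simp
      moreover have "(e r, y) \<in> carrier (P \<times>\<times> Q)"
        using r y(1) by simp
      ultimately show "r \<in> ?f ` carrier (P \<times>\<times> Q)"
        by (rule image_eqI)
    qed
  qed
  with inj have "?f \<in> iso (P \<times>\<times> Q) R"
    by (intro isoI hom) (simp add: bij_betw_def)
  then show ?thesis
    by (rule is_isoI)
qed

definition loop_last_class :: "nat \<Rightarrow> 'a topology \<Rightarrow> 'a \<Rightarrow> ((nat \<Rightarrow> real) \<Rightarrow> 'a) set \<Rightarrow>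
    ((nat \<Rightarrow> real) \<Rightarrow> complex \<Rightarrow> 'a) set" where
  "loop_last_class n B b X = (\<Union>g\<in>X. spheroid_class n (free_loop_space B b) (const_loop b) (loop_last n g))"

lemma loop_last_class:
  assumes n: "n \<ge> 1" and g: "spheroid (Suc n) B b g"
  shows "loop_last_class n B b (spheroid_class (Suc n) B b g)
       = spheroid_class n (free_loop_space B b) (const_loop b) (loop_last n g)"
  unfolding loop_last_class_def
proof (rule UN_eqI[OF spheroid_in_class[OF g]])
  fix f assume "f \<in> spheroid_class (Suc n) B b g"
  then have "spheroid_homotopic (Suc n) B b g f"
    by (simp add: spheroid_class_def)
  then show "spheroid_class n (free_loop_space B b) (const_loop b) (loop_last n f)
      = spheroid_class n (free_loop_space B b) (const_loop b) (loop_last n g)"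
    by (rule spheroid_class_eqI[OF spheroid_homotopic_sym[OF spheroid_homotopic_loop_last[OF n]]])
qed

lemma loop_last_hom:
  assumes n: "n \<ge> 1" and \<omega>: "based_map A a B b \<omega>"
  shows "loop_last_class n B b \<in> hom (image_group (Suc n) A a B b \<omega>)
    (image_group n (free_loop_space A a) (const_loop a) (free_loop_space B b) (const_loop b) (map_loop \<omega>))"
    (is "?j \<in> hom ?Q ?R")
proof (rule homI)
  note L\<omega> = based_map_map_loop[OF \<omega>]
  have n': "Suc n \<ge> 1" by simp
  have jc: "?j (spheroid_class (Suc n) B b (\<omega> \<circ> g))
      = spheroid_class n (free_loop_space B b) (const_loop b) (map_loop \<omega> \<circ> loop_last n g)"
    if "spheroid (Suc n) A a g" for g
  proof -
    have "map_loop \<omega> \<circ> loop_last n g = loop_last n (\<omega> \<circ> g)"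
      by (rule ext) (simp add: map_loop_loop_last)
    then show ?thesis
      by (simp only: loop_last_class[OF n based_map_spheroid[OF \<omega> that]])
  qed
  fix x assume "x \<in> carrier ?Q"
  then obtain f where f: "spheroid (Suc n) A a f" "x = spheroid_class (Suc n) B b (\<omega> \<circ> f)"
    by (rule image_groupE[OF \<omega>])
  show "?j x \<in> carrier ?R"
    unfolding f(2) jc[OF f(1)] by (rule image_groupI[OF L\<omega> spheroid_loop_last[OF n f(1)]])
  fix y assume "y \<in> carrier ?Q"
  then obtain g where g: "spheroid (Suc n) A a g" "y = spheroid_class (Suc n) B b (\<omega> \<circ> g)"
    by (rule image_groupE[OF \<omega>])
  show "?j (x \<otimes>\<^bsub>?Q\<^esub> y) = ?j x \<otimes>\<^bsub>?R\<^esub> ?j y"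
    by (simp only: f(2) g(2) mult_image_group mult_image_group_class[OF n' \<omega> f(1) g(1)] jc[OF f(1)] jc[OF g(1)]
        jc[OF spheroid_concat[OF n' f(1) g(1)]] loop_last_concat[OF n]
        mult_image_group_class[OF n L\<omega> spheroid_loop_last[OF n f(1)] spheroid_loop_last[OF n g(1)]])
qed

text \<open>Constant loops and evaluation at \<open>1\<close> give the split quotient \<open>P\<close>, the adjoint in the last
  coordinate gives the kernel \<open>Q\<close>. Exactness has to be shown for images: a class in the image of \<open>\<Lambda>\<omega>\<close> that
  evaluates to the trivial class in \<open>\<pi>\<^sub>n B\<close> may come from a spheroid \<open>F\<close> in \<open>\<Lambda>A\<close> whose evaluation \<open>f\<close> is not null homotopic
  in \<open>A\<close>. Multiplying \<open>F\<close> by the constant loops on the reverse of \<open>f\<close> repairs this in \<open>A\<close>, and leaves the class in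
  \<open>\<Lambda>B\<close> unchanged because \<open>\<omega> f\<close> is null homotopic.\<close>

theorem image_group_free_loop_space:
  assumes n: "n \<ge> 1" and \<omega>: "based_map A a B b \<omega>"
    and A: "path_connected_space A" and B: "path_connected_space B"
    and comm: "comm_group (image_group n (free_loop_space A a) (const_loop a)
      (free_loop_space B b) (const_loop b) (map_loop \<omega>))"
  shows "image_group n A a B b \<omega> \<times>\<times> image_group (Suc n) A a B b \<omega> \<cong>
    image_group n (free_loop_space A a) (const_loop a) (free_loop_space B b) (const_loop b) (map_loop \<omega>)"
    (is "?P \<times>\<times> ?Q \<cong> ?R")
proof -
  let ?LA = "free_loop_space A a" and ?LB = "free_loop_space B b"
  let ?i = "homotopy_induced n ?LB (const_loop b) const_loop"
  let ?j = "loop_last_class n B b"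
  let ?e = "homotopy_induced n B b (\<lambda>\<gamma>. \<gamma> 1)"
  note L\<omega> = based_map_map_loop[OF \<omega>]
  have n': "Suc n \<ge> 1" by simp
  have a: "a \<in> topspace A" and b: "b \<in> topspace B" and \<omega>a: "\<omega> a = b"
    using \<omega> based_map_base[OF \<omega>] by (auto simp: based_map_def)
  note cA = based_map_const_loop[OF A a] and cB = based_map_const_loop[OF B b]
  note eA = based_map_eval[OF a] and eB = based_map_eval[OF b]
  have i_class: "?i (spheroid_class n B b (\<omega> \<circ> f))
      = spheroid_class n ?LB (const_loop b) (map_loop \<omega> \<circ> (const_loop \<circ> f))"
    if "spheroid n A a f" for f
    using \<omega> cB that by (rule induced_image_class) (simp add: map_loop_const)
  have e_class: "?e (spheroid_class n ?LB (const_loop b) (map_loop \<omega> \<circ> F))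
      = spheroid_class n B b (\<omega> \<circ> ((\<lambda>\<gamma>. \<gamma> 1) \<circ> F))"
    if "spheroid n ?LA (const_loop a) F" for F
    using L\<omega> eB that by (rule induced_image_class) (simp add: map_loop_def)
  show ?thesis
  proof (rule split_extension_iso)
    show "group ?P" "group ?Q"
      using group_image_group[OF n \<omega>] group_image_group[OF n' \<omega>] .
    show "comm_group ?R" by (rule comm)
    show "?i \<in> hom ?P ?R"
      by (rule induced_hom_image_group[OF n \<omega> L\<omega> cB cA]) (simp add: map_loop_const)
    show "?j \<in> hom ?Q ?R"
      by (rule loop_last_hom[OF n \<omega>])
    show "?e \<in> hom ?R ?P"
      by (rule induced_hom_image_group[OF n L\<omega> \<omega> eB eA]) (simp add: map_loop_def)
  next
    fix x assume "x \<in> carrier ?P"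
    then obtain f where f: "spheroid n A a f" "x = spheroid_class n B b (\<omega> \<circ> f)"
      by (rule image_groupE[OF \<omega>])
    have "(\<lambda>\<gamma>. \<gamma> 1) \<circ> (const_loop \<circ> f) = f"
      by (auto simp: const_loop_def)
    then show "?e (?i x) = x"
      unfolding f(2) i_class[OF f(1)] e_class[OF based_map_spheroid[OF cA f(1)]] by simp
  next
    fix y assume "y \<in> carrier ?Q"
    then obtain g where g: "spheroid (Suc n) A a g" "y = spheroid_class (Suc n) B b (\<omega> \<circ> g)"
      by (rule image_groupE[OF \<omega>])
    note s = based_map_spheroid[OF \<omega> g(1)]
    have jy: "?j y = spheroid_class n ?LB (const_loop b) (loop_last n (\<omega> \<circ> g))"
      unfolding g(2) by (rule loop_last_class[OF n s])
    have "?e (?j y) = spheroid_class n B b ((\<lambda>\<gamma>. \<gamma> 1) \<circ> loop_last n (\<omega> \<circ> g))"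
      unfolding jy by (rule based_map_induced[OF eB spheroid_loop_last[OF n s]])
    also have "\<dots> = spheroid_class n B b (\<lambda>_. b)"
    proof (intro spheroid_class_eqI spheroid_homotopic_eq based_map_spheroid[OF eB] spheroid_loop_last[OF n s])
      fix p assume p: "p \<in> topspace (cube n)"
      then show "((\<lambda>\<gamma>. \<gamma> 1) \<circ> loop_last n (\<omega> \<circ> g)) p = b"
        using loop_last_cis[OF s p, of 0] spheroid_boundary[OF s cube_boundary_last[OF p, of 0]] by simp
    qed
    finally show "?e (?j y) = \<one>\<^bsub>?P\<^esub>"
      by (simp add: one_homotopy_group)
    assume "?j y = \<one>\<^bsub>?R\<^esub>"
    then have "spheroid_homotopic n ?LB (const_loop b) (loop_last n (\<omega> \<circ> g)) (\<lambda>_. const_loop b)"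
      using spheroid_class_eq_iff[OF spheroid_const[OF const_loop_in_free_loop_space[OF b]]]
      by (simp add: jy one_homotopy_group)
    then show "y = \<one>\<^bsub>?Q\<^esub>"
      using spheroid_class_eqI[OF null_homotopic_of_loop_last[OF n s]] by (simp add: g(2) one_homotopy_group)
  next
    fix r assume r: "r \<in> carrier ?R" and er: "?e r = \<one>\<^bsub>?P\<^esub>"
    obtain F where F: "spheroid n ?LA (const_loop a) F" "r = spheroid_class n ?LB (const_loop b) (map_loop \<omega> \<circ> F)"
      using r by (rule image_groupE[OF L\<omega>])
    define f where "f = (\<lambda>\<gamma>. \<gamma> 1) \<circ> F"
    have f: "spheroid n A a f"
      unfolding f_def by (rule based_map_spheroid[OF eA F(1)])
    note fr = spheroid_reverse[OF n f]
    let ?K = "spheroid_concat (const_loop \<circ> spheroid_reverse f) F"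
    have K: "spheroid n ?LA (const_loop a) ?K"
      by (rule spheroid_concat[OF n based_map_spheroid[OF cA fr] F(1)])
    have "(\<lambda>s. ?K s 1) = spheroid_concat (spheroid_reverse f) f"
      by (rule ext) (simp add: spheroid_concat_def f_def const_loop_def)
    then have "spheroid_homotopic n A a (\<lambda>s. ?K s 1) (\<lambda>_. a)"
      using spheroid_concat_reverse[OF n f] by simp
    then obtain g where g: "spheroid (Suc n) A a g"
      "spheroid_homotopic n ?LA (const_loop a) ?K (loop_last n g)"
      by (rule loop_last_of_null_evaluation[OF n K])
    interpret P: group ?P
      by (rule group_image_group[OF n \<omega>])
    interpret R: comm_group ?R
      by (rule comm)
    have f1: "spheroid_class n B b (\<omega> \<circ> f) = \<one>\<^bsub>?P\<^esub>"
      using er e_class[OF F(1)] by (simp add: F(2) f_def)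
    have "spheroid_class n B b (\<omega> \<circ> spheroid_reverse f)
        = inv\<^bsub>homotopy_group n B b\<^esub> (spheroid_class n B b (\<omega> \<circ> f))"
      by (simp only: inv_homotopy_group[OF n based_map_spheroid[OF \<omega> f]] comp_spheroid_reverse)
    also have "\<dots> = \<one>\<^bsub>homotopy_group n B b\<^esub>"
      using f1 group.is_monoid[OF group_homotopy_group[OF n b]] monoid.inv_one by fastforce
    finally have fr1: "spheroid_class n B b (\<omega> \<circ> spheroid_reverse f) = \<one>\<^bsub>?P\<^esub>"
      by simp
    have i_hom: "?i \<in> hom ?P ?R"
      by (rule induced_hom_image_group[OF n \<omega> L\<omega> cB cA]) (simp add: map_loop_const)
    have "spheroid_class n ?LB (const_loop b) (map_loop \<omega> \<circ> (const_loop \<circ> spheroid_reverse f)) = \<one>\<^bsub>?R\<^esub>"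
      using hom_one[OF i_hom P.is_group R.is_group] by (simp only: i_class[OF fr, symmetric] fr1)
    then have "spheroid_class n ?LB (const_loop b) (map_loop \<omega> \<circ> ?K) = \<one>\<^bsub>?R\<^esub> \<otimes>\<^bsub>?R\<^esub> r"
      by (simp only: F(2) mult_image_group mult_image_group_class[OF n L\<omega> based_map_spheroid[OF cA fr] F(1), symmetric])
    also have "\<dots> = r"
      using r by (rule R.l_one)
    finally have "r = spheroid_class n ?LB (const_loop b) (map_loop \<omega> \<circ> ?K)" ..
    also have "\<dots> = spheroid_class n ?LB (const_loop b) (map_loop \<omega> \<circ> loop_last n g)"
      by (rule spheroid_class_eqI[OF based_map_homotopic[OF L\<omega> g(2)]])
    also have "map_loop \<omega> \<circ> loop_last n g = loop_last n (\<omega> \<circ> g)"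
      by (rule ext) (simp add: map_loop_loop_last)
    also have "spheroid_class n ?LB (const_loop b) (loop_last n (\<omega> \<circ> g)) = ?j (spheroid_class (Suc n) B b (\<omega> \<circ> g))"
      by (rule loop_last_class[OF n based_map_spheroid[OF \<omega> g(1)], symmetric])
    finally show "r \<in> ?j ` carrier ?Q"
      using image_groupI[OF \<omega> g(1)] by (rule image_eqI)
  qed
qed

section \<open>Direct sums indexed by subsets\<close>

lemma carrier_finite_sum_group:
  assumes "finite I" "\<And>i. i \<in> I \<Longrightarrow> group (G i)"
  shows "carrier (sum_group I G) = (\<Pi>\<^sub>E i\<in>I. carrier (G i))"
  using assms by (simp add: carrier_sum_group)

lemma sum_group_singleton_iso:
  assumes "group (G i)"
  shows "sum_group {i} G \<cong> G i"
proof (rule is_isoI, rule isoI)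
  have c: "carrier (sum_group {i} G) = (\<Pi>\<^sub>E i\<in>{i}. carrier (G i))"
    using assms by (intro carrier_finite_sum_group) auto
  show "(\<lambda>u. u i) \<in> hom (sum_group {i} G) (G i)"
    by (rule homI) (auto simp: c)
  show "bij_betw (\<lambda>u. u i) (carrier (sum_group {i} G)) (carrier (G i))"
    unfolding c
    by (rule bij_betw_byWitness[where f' = "\<lambda>x. \<lambda>j\<in>{i}. x"])
      (auto simp: PiE_iff extensional_def fun_eq_iff split: if_splits)
qed

text \<open>Pascal's rule: subsets of \<open>{..<Suc N}\<close> are split according to whether they contain \<open>N\<close>.\<close>

lemma sum_group_Pow_Suc_iso:
  fixes G :: "nat \<Rightarrow> 'g monoid"
  assumes G: "\<And>k. group (G k)"
  shows "sum_group (Pow {..<N}) (\<lambda>J. G (card J)) \<times>\<times> sum_group (Pow {..<N}) (\<lambda>J. G (Suc (card J)))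
    \<cong> sum_group (Pow {..<Suc N}) (\<lambda>J. G (card J))"
    (is "?S \<times>\<times> ?T \<cong> ?U")
proof (rule is_isoI, rule isoI)
  have S: "carrier ?S = (\<Pi>\<^sub>E J\<in>Pow {..<N}. carrier (G (card J)))"
    and T: "carrier ?T = (\<Pi>\<^sub>E J\<in>Pow {..<N}. carrier (G (Suc (card J))))"
    and U: "carrier ?U = (\<Pi>\<^sub>E J\<in>Pow {..<Suc N}. carrier (G (card J)))"
    by (simp_all add: carrier_finite_sum_group G)
  let ?f = "\<lambda>(u, v). \<lambda>J\<in>Pow {..<Suc N}. if N \<in> J then v (J - {N}) else u J"
  let ?g = "\<lambda>w. (\<lambda>J\<in>Pow {..<N}. w J, \<lambda>J\<in>Pow {..<N}. w (insert N J))"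
  have sub: "J \<subseteq> {..<N} \<Longrightarrow> J \<subseteq> {..<Suc N}" "J \<subseteq> {..<N} \<Longrightarrow> N \<notin> J" for J
    by auto
  have card_ins: "card (insert N J) = Suc (card J)" if "J \<subseteq> {..<N}" for J
    using that sub(2)[OF that] by (simp add: finite_subset[of J "{..<N}"])
  have diff_sub: "J \<subseteq> {..<Suc N} \<Longrightarrow> N \<in> J \<Longrightarrow> J - {N} \<subseteq> {..<N}"
    "J \<subseteq> {..<Suc N} \<Longrightarrow> N \<notin> J \<Longrightarrow> J \<subseteq> {..<N}" for J
    by (auto simp: less_Suc_eq)
  have card_diff: "Suc (card (J - {N})) = card J" if "J \<subseteq> {..<Suc N}" "N \<in> J" for J
    using card_ins[OF diff_sub(1)[OF that]] that(2) by (simp add: insert_absorb)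
  have card_pred: "Suc (card J - Suc 0) = card J" if "J \<subseteq> {..<Suc N}" "N \<in> J" for J
    using card_diff[OF that] that(2) by simp
  have fU: "?f (u, v) \<in> carrier ?U" if u: "u \<in> carrier ?S" and v: "v \<in> carrier ?T" for u v
    unfolding U case_prod_conv
  proof (rule restrict_PiE_iff[THEN iffD2], intro ballI)
    fix J assume "J \<in> Pow {..<Suc N}"
    then have J: "J \<subseteq> {..<Suc N}" by simp
    show "(if N \<in> J then v (J - {N}) else u J) \<in> carrier (G (card J))"
    proof (cases "N \<in> J")
      case True
      have "v (J - {N}) \<in> carrier (G (Suc (card (J - {N}))))"
        using v diff_sub(1)[OF J True] by (simp add: T PiE_iff)
      then show ?thesis
        by (simp only: True if_True card_diff[OF J True])
    next
      case False
      have "u J \<in> carrier (G (card J))"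
        using u diff_sub(2)[OF J False] by (simp add: S PiE_iff)
      then show ?thesis
        by (simp only: False if_False)
    qed
  qed
  show "?f \<in> hom (?S \<times>\<times> ?T) ?U"
  proof (rule homI)
    fix p assume "p \<in> carrier (?S \<times>\<times> ?T)"
    then show "?f p \<in> carrier ?U"
      using fU by (cases p) auto
  next
    fix p q
    show "?f (p \<otimes>\<^bsub>?S \<times>\<times> ?T\<^esub> q) = ?f p \<otimes>\<^bsub>?U\<^esub> ?f q"
      by (cases p; cases q) (auto simp: fun_eq_iff card_pred diff_sub)
  qed
  show "bij_betw ?f (carrier (?S \<times>\<times> ?T)) (carrier ?U)"
  proof (rule bij_betw_byWitness[where f' = ?g])
    show "\<forall>p\<in>carrier (?S \<times>\<times> ?T). ?g (?f p) = p"
    proof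
      fix p assume p: "p \<in> carrier (?S \<times>\<times> ?T)"
      obtain u v where uv: "p = (u, v)" by (cases p)
      have ext: "u \<in> extensional (Pow {..<N})" "v \<in> extensional (Pow {..<N})"
        using p by (auto simp: uv S T PiE_iff)
      have "(\<lambda>J\<in>Pow {..<N}. ?f p J) = u"
        by (rule extensionalityI[OF restrict_extensional ext(1)]) (auto simp: uv sub)
      moreover have "(\<lambda>J\<in>Pow {..<N}. ?f p (insert N J)) = v"
      proof (rule extensionalityI[OF restrict_extensional ext(2)])
        fix J assume J: "J \<in> Pow {..<N}"
        then have "insert N J - {N} = J" by auto
        then show "(\<lambda>J\<in>Pow {..<N}. ?f p (insert N J)) J = v J"
          using J by (auto simp: uv)
      qed
      ultimately show "?g (?f p) = p"
        by (simp only: uv)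
    qed
    show "\<forall>w\<in>carrier ?U. ?f (?g w) = w"
    proof
      fix w assume w: "w \<in> carrier ?U"
      show "?f (?g w) = w"
        unfolding case_prod_conv
      proof (rule extensionalityI[OF restrict_extensional])
        show "w \<in> extensional (Pow {..<Suc N})"
          using w by (simp add: U PiE_iff)
        fix J assume "J \<in> Pow {..<Suc N}"
        then show "(\<lambda>J\<in>Pow {..<Suc N}. if N \<in> J then (\<lambda>J\<in>Pow {..<N}. w (insert N J)) (J - {N})
            else (\<lambda>J\<in>Pow {..<N}. w J) J) J = w J"
          using diff_sub[of J] by (auto simp: insert_absorb)
      qed
    qed
    show "?f ` carrier (?S \<times>\<times> ?T) \<subseteq> carrier ?U"
      using fU by auto
    show "?g ` carrier ?U \<subseteq> carrier (?S \<times>\<times> ?T)"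
    proof
      fix p assume "p \<in> ?g ` carrier ?U"
      then obtain w where w: "w \<in> carrier ?U" "p = ?g w" by blast
      have wJ: "w J \<in> carrier (G (card J))" if "J \<subseteq> {..<Suc N}" for J
        using w(1) that by (auto simp: U PiE_iff)
      have "w (insert N J) \<in> carrier (G (Suc (card J)))" if "J \<subseteq> {..<N}" for J
        using wJ[of "insert N J"] card_ins[OF that] sub(1)[OF that] by simp
      then show "p \<in> carrier (?S \<times>\<times> ?T)"
        using wJ sub(1) by (simp add: w(2) S T)
    qed
  qed
qed

lemma sum_group_Pow_regroup_iso:
  fixes G :: "nat \<Rightarrow> 'g monoid"
  assumes G: "\<And>k. group (G k)"
  shows "sum_group (Pow {..<N}) (\<lambda>J. G (card J)) \<cong> sum_group {0..N} (\<lambda>j. copies (N choose j) (G j))"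
    (is "?S \<cong> ?T")
proof -
  let ?F = "\<lambda>j. {J. J \<subseteq> {..<N} \<and> card J = j}"
  have "\<exists>e. bij_betw e {..<N choose j} (?F j)" for j
  proof -
    have "finite (?F j)"
      by (rule finite_subset[of _ "Pow {..<N}"]) auto
    from ex_bij_betw_nat_finite[OF this] show ?thesis
      by (simp add: n_subsets atLeast0LessThan)
  qed
  then obtain e where e: "\<And>j. bij_betw (e j) {..<N choose j} (?F j)"
    by metis
  define d where "d = (\<lambda>j. inv_into {..<N choose j} (e j))"
  have e_in: "e j i \<subseteq> {..<N}" "card (e j i) = j" if "i < N choose j" for i j
    using bij_betwE[OF e[of j]] that by auto
  have d_in: "d (card J) J < N choose card J" and ed: "e (card J) (d (card J) J) = J" if "J \<subseteq> {..<N}" for J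
  proof -
    have "J \<in> e (card J) ` {..<N choose card J}"
      using that e[of "card J"] by (auto simp: bij_betw_def)
    from inv_into_into[OF this] f_inv_into_f[OF this]
    show "d (card J) J < N choose card J" "e (card J) (d (card J) J) = J"
      by (simp_all add: d_def)
  qed
  have de: "d j (e j i) = i" if "i < N choose j" for i j
    using e[of j] that by (auto simp: d_def bij_betw_def)
  have card_le: "card J \<le> N" if "J \<subseteq> {..<N}" for J
    using card_mono[OF _ that] by simp
  have gc: "group (copies k (G j))" for k j
    unfolding copies_def by (rule sum_group) (rule G)
  have C: "carrier (copies k (G j)) = (\<Pi>\<^sub>E i\<in>{..<k}. carrier (G j))" for k j
    unfolding copies_def by (rule carrier_finite_sum_group) (auto simp: G)
  have S: "carrier ?S = (\<Pi>\<^sub>E J\<in>Pow {..<N}. carrier (G (card J)))"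
    by (rule carrier_finite_sum_group) (auto simp: G)
  have T: "carrier ?T = (\<Pi>\<^sub>E j\<in>{0..N}. \<Pi>\<^sub>E i\<in>{..<N choose j}. carrier (G j))"
    using carrier_finite_sum_group[of "{0..N}" "\<lambda>j. copies (N choose j) (G j)"] gc by (simp add: C)
  let ?f = "\<lambda>u. \<lambda>j\<in>{0..N}. \<lambda>i\<in>{..<N choose j}. u (e j i)"
  let ?g = "\<lambda>w. \<lambda>J\<in>Pow {..<N}. w (card J) (d (card J) J)"
  have fT: "?f u \<in> carrier ?T" if u: "u \<in> carrier ?S" for u
  proof -
    have "u (e j i) \<in> carrier (G j)" if "i < N choose j" for i j
    proof -
      have "u (e j i) \<in> carrier (G (card (e j i)))"
        using u e_in(1)[OF that] by (simp add: S PiE_iff)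
      then show ?thesis
        by (simp only: e_in(2)[OF that])
    qed
    then show ?thesis
      by (simp add: T)
  qed
  have gS: "?g w \<in> carrier ?S" if w: "w \<in> carrier ?T" for w
  proof -
    have "w (card J) (d (card J) J) \<in> carrier (G (card J))" if "J \<subseteq> {..<N}" for J
      using w d_in[OF that] card_le[OF that] by (simp add: T PiE_iff)
    then show ?thesis
      by (simp add: S)
  qed
  have "?f \<in> iso ?S ?T"
  proof (rule isoI)
    show "?f \<in> hom ?S ?T"
    proof (rule homI)
      fix u v
      show "?f (u \<otimes>\<^bsub>?S\<^esub> v) = ?f u \<otimes>\<^bsub>?T\<^esub> ?f v"
        by (auto simp: fun_eq_iff copies_def e_in)
    qed (rule fT)
    show "bij_betw ?f (carrier ?S) (carrier ?T)"
    proof (rule bij_betw_byWitness[where f' = ?g])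
      show "\<forall>u\<in>carrier ?S. ?g (?f u) = u"
      proof
        fix u assume u: "u \<in> carrier ?S"
        show "?g (?f u) = u"
        proof (rule extensionalityI[OF restrict_extensional])
          show "u \<in> extensional (Pow {..<N})"
            using u by (simp add: S PiE_iff)
        qed (simp add: d_in ed card_le)
      qed
      show "\<forall>w\<in>carrier ?T. ?f (?g w) = w"
      proof
        fix w assume w: "w \<in> carrier ?T"
        show "?f (?g w) = w"
        proof (rule extensionalityI[OF restrict_extensional])
          show "w \<in> extensional {0..N}"
            using w by (simp add: T PiE_iff)
          fix j assume j: "j \<in> {0..N}"
          then have "w j \<in> extensional {..<N choose j}"
            using w by (simp add: T PiE_iff)
          then have "(\<lambda>i\<in>{..<N choose j}. ?g w (e j i)) = w j"
            by (rule extensionalityI[OF restrict_extensional]) (simp add: e_in de)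
          then show "?f (?g w) j = w j"
            using j by simp
        qed
      qed
    qed (use fT gS in blast)+
  qed
  then show ?thesis
    by (rule is_isoI)
qed

section \<open>Evaluation subgroups of the iterated free loop spaces\<close>

lemma continuous_map_postcompose:
  assumes X: "locally_compact_space X" "Hausdorff_space X"
    and f: "continuous_map X Z f" "f \<in> extensional (topspace X)" and h: "continuous_map Z Z' h"
    and f': "f' \<in> extensional (topspace X)" "\<And>x. x \<in> topspace X \<Longrightarrow> h (f x) = f' x"
  shows "continuous_map (mapping_component X Z f) (mapping_component X Z' f') (\<lambda>g. \<lambda>x\<in>topspace X. h (g x))"
proof -
  let ?P = "mapping_component X Z f"
  have "continuous_map (prod_topology ?P X) Z (\<lambda>q. fst q (snd q))"
    by (rule continuous_map_uncurry_component[OF X, where g = "\<lambda>g. g" and P = ?P and f = f])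
      (simp_all add: continuous_map_id[unfolded id_def] continuous_map_fst continuous_map_snd)
  then have "continuous_map (prod_topology ?P X) Z' (\<lambda>q. h (fst q (snd q)))"
    by (rule continuous_map_compose1[OF h])
  from continuous_map_curry_component[OF path_connected_space_mapping_component
      base_in_mapping_component[OF f] this f'(1)]
  show ?thesis
    using f'(2) by simp
qed

lemma based_map_evaluation:
  assumes X: "locally_compact_space X" "Hausdorff_space X" and x: "x \<in> topspace X"
    and f: "continuous_map X Z f" "f \<in> extensional (topspace X)" and z: "f x = z"
  shows "based_map (mapping_component X Z f) f Z z (\<lambda>g. g x)"
  unfolding based_map_def
proof (intro conjI base_in_mapping_component f z)
  show "continuous_map (mapping_component X Z f) Z (\<lambda>g. g x)"
    by (rule continuous_map_uncurry_component[OF X, where g = "\<lambda>g. g" and P = "mapping_component X Z f" and f = f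
          and p = "\<lambda>g. g" and q = "\<lambda>_. x"])
      (simp_all add: continuous_map_id[unfolded id_def] x)
qed

lemma path_connected_space_prod:
  "path_connected_space A \<Longrightarrow> path_connected_space B \<Longrightarrow> path_connected_space (prod_topology A B)"
  by (simp add: path_connected_space_prod_topology)

locale connected_based_space =
  fixes Y :: "'a topology" and y :: 'a
  assumes y: "y \<in> topspace Y" and path_connected: "path_connected_space Y"
    and locally_compact: "locally_compact_space Y" and Hausdorff: "Hausdorff_space Y"
begin

abbreviation E :: "nat \<Rightarrow> 'a iterated_loop topology" where
  "E N \<equiv> iterated_free_loop_space N Y y"

abbreviation e :: "nat \<Rightarrow> 'a iterated_loop" where
  "e N \<equiv> iterated_const_loop N y"

text \<open>The map of \<open>Y\<close> into the iterated free loop space by constant loops, in the form that makes it a point of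
  the mapping space.\<close>

definition c :: "nat \<Rightarrow> 'a \<Rightarrow> 'a iterated_loop" where
  "c N = (\<lambda>x\<in>topspace Y. iterated_const_loop N x)"

definition M :: "nat \<Rightarrow> ('a \<Rightarrow> 'a iterated_loop) topology" where
  "M N = mapping_component Y (E N) (c N)"

lemma Loop_homeomorphic:
  "homeomorphic_maps (free_loop_space (E N) (e N)) (E (Suc N)) Loop the_loop"
  by (rule iterated_free_loop_space_Suc_homeomorphic)

lemma continuous_map_Loop: "continuous_map (free_loop_space (E N) (e N)) (E (Suc N)) Loop"
  and continuous_map_the_loop: "continuous_map (E (Suc N)) (free_loop_space (E N) (e N)) the_loop"
  and Loop_the_loop: "x \<in> topspace (E (Suc N)) \<Longrightarrow> Loop (the_loop x) = x"
  using Loop_homeomorphic[of N] unfolding homeomorphic_maps_def by blast+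

lemma path_connected_E: "path_connected_space (E N)"
proof (cases N)
  case 0
  have "Y homeomorphic_space E 0"
    using iterated_free_loop_space_0_homeomorphic[of Y y] unfolding homeomorphic_space_def by blast
  then show ?thesis
    unfolding 0 by (rule homeomorphic_path_connected_space_imp[OF path_connected])
next
  case (Suc K)
  have "free_loop_space (E K) (e K) homeomorphic_space E (Suc K)"
    using Loop_homeomorphic[of K] unfolding homeomorphic_space_def by blast
  then show ?thesis
    unfolding Suc by (rule homeomorphic_path_connected_space_imp[OF path_connected_free_loop_space])
qed

lemma continuous_map_iterated_const_loop: "continuous_map Y (E N) (iterated_const_loop N)"
proof (induction N)
  case 0
  have "continuous_map Y (E 0) Point"
    using iterated_free_loop_space_0_homeomorphic[of Y y] unfolding homeomorphic_maps_def by blast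
  then show ?case
    by (simp add: iterated_const_loop.simps(1)[abs_def])
next
  case (Suc N)
  have "e N \<in> topspace (E N)"
    using Suc y by (auto simp: continuous_map_def)
  from based_map_const_loop[OF path_connected_E this]
  have "continuous_map (E N) (free_loop_space (E N) (e N)) const_loop"
    by (simp add: based_map_def)
  from continuous_map_compose1[OF continuous_map_Loop continuous_map_compose1[OF this Suc]]
  show ?case
    by (simp add: iterated_const_loop.simps(2)[abs_def] del: iterated_free_loop_space.simps)
qed

lemma e_in_E: "e N \<in> topspace (E N)"
  using continuous_map_iterated_const_loop[of N] y by (auto simp: continuous_map_def)

lemma c_apply: "x \<in> topspace Y \<Longrightarrow> c N x = iterated_const_loop N x"
  by (simp add: c_def)

lemma continuous_map_c: "continuous_map Y (E N) (c N)"
  by (rule continuous_map_eq[OF continuous_map_iterated_const_loop]) (simp add: c_def)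

lemma c_extensional: "c N \<in> extensional (topspace Y)"
  by (simp add: c_def)

lemma c_in_M: "c N \<in> topspace (M N)"
  unfolding M_def by (rule base_in_mapping_component[OF continuous_map_c c_extensional])

lemma path_connected_M: "path_connected_space (M N)"
  unfolding M_def by (rule path_connected_space_mapping_component)

lemma M_apply: "f \<in> topspace (M N) \<Longrightarrow> x \<in> topspace Y \<Longrightarrow> f x \<in> topspace (E N)"
  using mem_mapping_componentD[of f Y "E N" "c N"] by (simp add: M_def continuous_map_def Pi_iff)

lemma continuous_map_M_eval:
  assumes "continuous_map Q (M N) f" "continuous_map Q Y x"
  shows "continuous_map Q (E N) (\<lambda>q. f q (x q))"
  by (rule continuous_map_uncurry_component[OF locally_compact Hausdorff, where g = "\<lambda>g. g" and P = "M N" and f = "c N"])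
    (simp_all add: continuous_map_id[unfolded id_def] assms flip: M_def)

lemma continuous_map_into_M:
  assumes P: "path_connected_space P" "p \<in> topspace P"
    and F: "continuous_map (prod_topology P Y) (E N) (\<lambda>q. F (fst q) (snd q))"
    and b: "\<And>x. x \<in> topspace Y \<Longrightarrow> F p x = c N x"
  shows "continuous_map P (M N) (\<lambda>p. \<lambda>x\<in>topspace Y. F p x)"
  using continuous_map_curry_component[OF P F c_extensional] b by (simp add: M_def)

lemma based_map_M: "based_map (M N) (c N) (E N) (e N) (\<lambda>f. f y)"
  unfolding M_def
  by (rule based_map_evaluation[OF locally_compact Hausdorff y continuous_map_c c_extensional]) (simp add: c_apply y)

text \<open>The interchange of the variable in \<open>Y\<close> with the loop variable, and its inverse.\<close>

definition transpose :: "('a \<Rightarrow> 'a iterated_loop) \<Rightarrow> complex \<Rightarrow> 'a \<Rightarrow> 'a iterated_loop" where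
  "transpose f = (\<lambda>z\<in>topspace circle. \<lambda>x\<in>topspace Y. the_loop (f x) z)"

definition untranspose :: "(complex \<Rightarrow> 'a \<Rightarrow> 'a iterated_loop) \<Rightarrow> 'a \<Rightarrow> 'a iterated_loop" where
  "untranspose \<gamma> = (\<lambda>x\<in>topspace Y. Loop (\<lambda>z\<in>topspace circle. \<gamma> z x))"

lemma transpose_c: "z \<in> topspace circle \<Longrightarrow> transpose (c (Suc N)) z = c N"
  by (auto simp: transpose_def c_def const_loop_def)

lemma untranspose_const: "untranspose (const_loop (c N)) = c (Suc N)"
  by (auto simp: untranspose_def c_def const_loop_def fun_eq_iff)

text \<open>By uncurrying in \<open>Y\<close> and in the circle, and currying again in the opposite order.\<close>

lemma based_map_transpose:
  "based_map (M (Suc N)) (c (Suc N)) (free_loop_space (M N) (c N)) (const_loop (c N)) transpose"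
  unfolding based_map_def
proof (intro conjI c_in_M)
  let ?P = "prod_topology (M (Suc N)) circle"
  have "continuous_map (prod_topology ?P Y) (E (Suc N)) (\<lambda>q. fst (fst q) (snd q))"
    by (rule continuous_map_M_eval[OF continuous_map_fst_fst continuous_map_snd])
  from continuous_map_compose1[OF continuous_map_the_loop this]
  have "continuous_map (prod_topology ?P Y) (E N) (\<lambda>q. the_loop (fst (fst q) (snd q)) (snd (fst q)))"
    by (rule continuous_map_free_loop_eval[where p = "\<lambda>q. q" and g = "\<lambda>q. the_loop (fst (fst q) (snd q))",
          OF _ _ continuous_map_snd_fst]) (simp add: continuous_map_id[unfolded id_def])
  then have 1: "continuous_map ?P (M N) (\<lambda>q. \<lambda>x\<in>topspace Y. the_loop (fst q x) (snd q))"
  proof (rule continuous_map_into_M[where p = "(c (Suc N), 1)", rotated 2])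
    show "path_connected_space ?P"
      by (rule path_connected_space_prod[OF path_connected_M path_connected_circle])
    show "(c (Suc N), 1) \<in> topspace ?P"
      using c_in_M by simp
  qed (simp add: c_def)
  show "continuous_map (M (Suc N)) (free_loop_space (M N) (c N)) transpose"
    unfolding transpose_def[abs_def]
  proof (rule continuous_map_into_free_loop_space[OF path_connected_M c_in_M])
    show "continuous_map ?P (M N) (\<lambda>q. \<lambda>x\<in>topspace Y. the_loop (fst q x) (snd q))"
      by (rule 1)
    show "(\<lambda>x\<in>topspace Y. the_loop (c (Suc N) x) z) = c N" if "z \<in> topspace circle" for z
      using transpose_c[OF that, of N] that by (simp add: transpose_def)
  qed
  show "transpose (c (Suc N)) = const_loop (c N)"
  proof (rule extensionalityI[OF _ const_loop_extensional])
    show "transpose (c (Suc N)) \<in> extensional (topspace circle)"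
      by (simp add: transpose_def)
    show "transpose (c (Suc N)) z = const_loop (c N) z" if "z \<in> topspace circle" for z
      using that by (simp only: transpose_c const_loop_apply)
  qed
qed

lemma based_map_untranspose:
  "based_map (free_loop_space (M N) (c N)) (const_loop (c N)) (M (Suc N)) (c (Suc N)) untranspose"
  unfolding based_map_def
proof (intro conjI untranspose_const const_loop_in_free_loop_space c_in_M)
  let ?L = "free_loop_space (M N) (c N)"
  let ?P = "prod_topology ?L Y"
  have "continuous_map (prod_topology ?P circle) (M N) (\<lambda>q. fst (fst q) (snd q))"
    by (rule continuous_map_free_loop_eval[where g = "\<lambda>q. q" and b = "c N", OF _ continuous_map_fst_fst continuous_map_snd])
      (simp add: continuous_map_id[unfolded id_def])
  then have "continuous_map (prod_topology ?P circle) (E N) (\<lambda>q. fst (fst q) (snd q) (snd (fst q)))"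
    by (rule continuous_map_M_eval[OF _ continuous_map_snd_fst])
  then have "continuous_map ?P (free_loop_space (E N) (e N)) (\<lambda>q. \<lambda>z\<in>topspace circle. fst q z (snd q))"
  proof (rule continuous_map_into_free_loop_space[where p = "(const_loop (c N), y)", rotated 2])
    show "path_connected_space ?P"
      by (rule path_connected_space_prod[OF path_connected_free_loop_space path_connected])
    show "(const_loop (c N), y) \<in> topspace ?P"
      using const_loop_in_free_loop_space[OF c_in_M] y by simp
  qed (simp add: c_apply y)
  from continuous_map_compose1[OF continuous_map_Loop this]
  show "continuous_map ?L (M (Suc N)) untranspose"
    unfolding untranspose_def[abs_def]
    by (rule continuous_map_into_M[OF path_connected_free_loop_space const_loop_in_free_loop_space[OF c_in_M]])
      (auto simp: c_def const_loop_def)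
qed

lemma the_loop_restrict:
  assumes "x \<in> topspace (E (Suc N))"
  shows "Loop (\<lambda>z\<in>topspace circle. the_loop x z) = x"
proof -
  have "the_loop x \<in> topspace (free_loop_space (E N) (e N))"
    using continuous_map_the_loop assms unfolding continuous_map_def by blast
  then have "(\<lambda>z\<in>topspace circle. the_loop x z) = the_loop x"
    by (intro extensional_restrict free_loop_extensional)
  then show ?thesis
    using Loop_the_loop[OF assms] by simp
qed

text \<open>The action of maps \<open>Y \<rightarrow> E N\<close> on \<open>E N\<close> that extends evaluation. A map into \<open>E (Suc N)\<close> is a loop of
  maps into \<open>E N\<close>, and acts on a loop in \<open>E N\<close> pointwise. Its curried form turns spheroids in \<open>M N\<close> into
  spheroids in the self-maps of \<open>E N\<close>.\<close>

lemma exists_action: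
  "\<exists>\<alpha>. continuous_map (prod_topology (M N) (E N)) (E N) (\<lambda>q. \<alpha> (fst q) (snd q)) \<and>
    (\<forall>x\<in>topspace (E N). \<alpha> (c N) x = x) \<and> (\<forall>f\<in>topspace (M N). \<alpha> f (e N) = f y)"
proof (induction N)
  case 0
  have hm: "homeomorphic_maps Y (E 0) Point the_point"
    by (rule iterated_free_loop_space_0_homeomorphic)
  then have tp: "continuous_map (E 0) Y the_point" and Pt: "\<And>x. x \<in> topspace (E 0) \<Longrightarrow> Point (the_point x) = x"
    by (auto simp: homeomorphic_maps_def)
  have "continuous_map (prod_topology (M 0) (E 0)) (E 0) (\<lambda>q. fst q (the_point (snd q)))"
    by (rule continuous_map_M_eval[OF continuous_map_fst continuous_map_compose1[OF tp continuous_map_snd]])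
  moreover have "c 0 (the_point x) = x" if "x \<in> topspace (E 0)" for x
    using Pt[OF that] tp that by (auto simp: c_def continuous_map_def)
  ultimately show ?case
    by (intro exI[of _ "\<lambda>f x. f (the_point x)"]) simp
next
  case (Suc N)
  then obtain \<alpha> where \<alpha>: "continuous_map (prod_topology (M N) (E N)) (E N) (\<lambda>q. \<alpha> (fst q) (snd q))"
    and unit: "\<And>x. x \<in> topspace (E N) \<Longrightarrow> \<alpha> (c N) x = x"
    and base: "\<And>f. f \<in> topspace (M N) \<Longrightarrow> \<alpha> f (e N) = f y"
    by blast
  let ?P = "prod_topology (M (Suc N)) (E (Suc N))"
  let ?\<alpha> = "\<lambda>f x. Loop (\<lambda>z\<in>topspace circle. \<alpha> (transpose f z) (the_loop x z))"
  have tr: "continuous_map (M (Suc N)) (free_loop_space (M N) (c N)) transpose"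
    using based_map_transpose by (simp add: based_map_def)
  have 1: "continuous_map (prod_topology ?P circle) (M N) (\<lambda>q. transpose (fst (fst q)) (snd q))"
    by (rule continuous_map_free_loop_eval[OF tr continuous_map_fst_fst continuous_map_snd])
  have 2: "continuous_map (prod_topology ?P circle) (E N) (\<lambda>q. the_loop (snd (fst q)) (snd q))"
    by (rule continuous_map_free_loop_eval[OF continuous_map_the_loop continuous_map_snd_fst continuous_map_snd])
  have "continuous_map ?P (free_loop_space (E N) (e N)) (\<lambda>q. \<lambda>z\<in>topspace circle. \<alpha> (transpose (fst q) z) (the_loop (snd q) z))"
  proof (rule continuous_map_into_free_loop_space[where p = "(c (Suc N), e (Suc N))"])
    show "path_connected_space ?P"
      by (rule path_connected_space_prod[OF path_connected_M path_connected_E])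
    show "(c (Suc N), e (Suc N)) \<in> topspace ?P"
      using c_in_M e_in_E by (simp only: topspace_prod_topology mem_Times_iff fst_conv snd_conv)
    show "continuous_map (prod_topology ?P circle) (E N)
        (\<lambda>q. \<alpha> (transpose (fst (fst q)) (snd q)) (the_loop (snd (fst q)) (snd q)))"
      by (rule continuous_map_compose2[OF \<alpha> 1 2])
    show "\<alpha> (transpose (fst (c (Suc N), e (Suc N))) z) (the_loop (snd (c (Suc N), e (Suc N))) z) = e N"
      if z: "z \<in> topspace circle" for z
      using z by (simp add: transpose_c[OF z] unit e_in_E const_loop_def)
  qed
  from continuous_map_compose1[OF continuous_map_Loop this]
  have cont: "continuous_map ?P (E (Suc N)) (\<lambda>q. ?\<alpha> (fst q) (snd q))" .
  moreover have "?\<alpha> (c (Suc N)) x = x" if x: "x \<in> topspace (E (Suc N))" for x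
  proof -
    have "the_loop x \<in> topspace (free_loop_space (E N) (e N))"
      using continuous_map_the_loop x unfolding continuous_map_def by blast
    then have "\<alpha> (transpose (c (Suc N)) z) (the_loop x z) = the_loop x z" if "z \<in> topspace circle" for z
      unfolding transpose_c[OF that] by (rule unit[OF free_loop_in_topspace[OF _ that]])
    then have "(\<lambda>z\<in>topspace circle. \<alpha> (transpose (c (Suc N)) z) (the_loop x z)) = (\<lambda>z\<in>topspace circle. the_loop x z)"
      by (rule restrict_ext)
    then show ?thesis
      by (simp only: the_loop_restrict[OF x])
  qed
  moreover have "?\<alpha> f (e (Suc N)) = f y" if f: "f \<in> topspace (M (Suc N))" for f
  proof -
    have tf: "transpose f \<in> topspace (free_loop_space (M N) (c N))"
      using tr f unfolding continuous_map_def by blast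
    have "\<alpha> (transpose f z) (the_loop (e (Suc N)) z) = the_loop (f y) z" if "z \<in> topspace circle" for z
    proof -
      have "the_loop (e (Suc N)) z = e N"
        using that by (simp add: const_loop_def)
      then have "\<alpha> (transpose f z) (the_loop (e (Suc N)) z) = transpose f z y"
        by (simp only: base[OF free_loop_in_topspace[OF tf that]])
      also have "\<dots> = the_loop (f y) z"
        using that y by (simp add: transpose_def)
      finally show ?thesis .
    qed
    then have "(\<lambda>z\<in>topspace circle. \<alpha> (transpose f z) (the_loop (e (Suc N)) z)) = (\<lambda>z\<in>topspace circle. the_loop (f y) z)"
      by (rule restrict_ext)
    then show ?thesis
      by (simp only: the_loop_restrict[OF M_apply[OF f y]])
  qed
  ultimately show ?case
    by (intro exI[of _ ?\<alpha>] conjI ballI)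
qed

abbreviation evaluation_group :: "nat \<Rightarrow> nat \<Rightarrow> ((nat \<Rightarrow> real) \<Rightarrow> 'a iterated_loop) set monoid" where
  "evaluation_group n N \<equiv> image_group n (M N) (c N) (E N) (e N) (\<lambda>f. f y)"

text \<open>The pairing \<open>(f, g) \<mapsto> \<alpha> f (g y)\<close> is evaluation on both axes.\<close>

lemma comm_evaluation_group:
  assumes n: "n \<ge> 1"
  shows "comm_group (evaluation_group n N)"
proof -
  obtain \<alpha> where \<alpha>: "continuous_map (prod_topology (M N) (E N)) (E N) (\<lambda>q. \<alpha> (fst q) (snd q))"
    and unit: "\<And>x. x \<in> topspace (E N) \<Longrightarrow> \<alpha> (c N) x = x"
    and base: "\<And>f. f \<in> topspace (M N) \<Longrightarrow> \<alpha> f (e N) = f y"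
    using exists_action[of N] by blast
  have ev: "continuous_map (M N) (E N) (\<lambda>f. f y)"
    using based_map_M by (simp add: based_map_def)
  have "continuous_map (prod_topology (M N) (M N)) (E N) (\<lambda>q. \<alpha> (fst q) (snd q y))"
    by (rule continuous_map_compose2[OF \<alpha> continuous_map_fst continuous_map_compose1[OF ev continuous_map_snd]])
  then show ?thesis
    by (rule comm_group_image_group[OF n based_map_M])
      (simp_all add: c_apply y base unit M_apply)
qed

text \<open>The action gives \<open>M N \<rightarrow> aut\<^sub>1 (E N)\<close>, restriction along \<open>c N\<close> gives \<open>aut\<^sub>1 (E N) \<rightarrow> M N\<close>. Both are
  compatible with evaluation at the base points, so the two images in \<open>\<pi>\<^sub>n (E N)\<close> agree.\<close>

lemma evaluation_group_iso_gottlieb_group: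
  assumes n: "n \<ge> 1"
  shows "evaluation_group n N \<cong> gottlieb_group n (E N) (e N)"
proof -
  obtain \<alpha> where \<alpha>: "continuous_map (prod_topology (M N) (E N)) (E N) (\<lambda>q. \<alpha> (fst q) (snd q))"
    and unit: "\<And>x. x \<in> topspace (E N) \<Longrightarrow> \<alpha> (c N) x = x"
    and base: "\<And>f. f \<in> topspace (M N) \<Longrightarrow> \<alpha> f (e N) = f y"
    using exists_action[of N] by blast
  let ?A = "aut1 (E N)" and ?i = "identity_map (E N)"
  let ?u = "\<lambda>f. \<lambda>x\<in>topspace (E N). \<alpha> f x" and ?v = "\<lambda>g. \<lambda>x\<in>topspace Y. g (c N x)"
  have i: "?i \<in> extensional (topspace (E N))" "continuous_map (E N) (E N) ?i"
    by (auto simp: identity_map_def intro: continuous_map_eq[OF continuous_map_id])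
  have iA: "?i \<in> topspace ?A"
    unfolding aut1_def by (rule base_in_mapping_component[OF i(2,1)])
  have pA: "path_connected_space ?A"
    unfolding aut1_def by (rule path_connected_space_mapping_component)
  have cE: "c N x \<in> topspace (E N)" if "x \<in> topspace Y" for x
    by (rule M_apply[OF c_in_M that])
  have u: "based_map (M N) (c N) ?A ?i ?u"
    unfolding based_map_def
  proof (intro conjI c_in_M)
    show "continuous_map (M N) ?A ?u"
      using continuous_map_curry_component[OF path_connected_M c_in_M \<alpha> i(1)]
      by (simp add: aut1_def identity_map_def unit)
    show "?u (c N) = ?i"
      unfolding identity_map_def by (rule restrict_ext) (rule unit)
  qed
  have v_base: "?v ?i = c N"
    by (rule extensionalityI[OF restrict_extensional c_extensional]) (simp add: identity_map_def cE)
  have v_cont: "continuous_map ?A (M N) ?v"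
    unfolding M_def
  proof (rule continuous_map_into_mapping_component[where p = ?i, OF pA iA])
    show "continuous_map ?A (mapping_space Y (E N)) ?v"
      unfolding aut1_def mapping_component_def
      by (rule continuous_map_from_subtopology[OF continuous_map_precompose[OF continuous_map_c]])
  qed (rule v_base)
  have v: "based_map ?A ?i (M N) (c N) ?v"
    unfolding based_map_def by (intro conjI iA v_cont v_base)
  have vy: "?v g y = g (e N)" for g
    using y by (simp add: c_apply)
  have ev: "continuous_map (M N) (E N) (\<lambda>f. f y)"
    using based_map_M by (simp add: based_map_def)
  have \<omega>: "based_map ?A ?i (E N) (e N) (\<lambda>g. g (e N))"
    unfolding based_map_def
  proof (intro conjI iA)
    show "continuous_map ?A (E N) (\<lambda>g. g (e N))"
      using continuous_map_compose1[OF ev v_cont] unfolding vy .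
    show "?i (e N) = e N"
      using e_in_E by (simp add: identity_map_def)
  qed
  have "evaluation_group n N \<cong> image_group n ?A ?i (E N) (e N) (\<lambda>g. g (e N))"
  proof (rule image_group_iso[OF n based_map_M \<omega> _ _ u v])
    show "homeomorphic_maps (E N) (E N) id id"
      by (simp add: homeomorphic_maps_def)
    show "?u f (e N) = id (f y)" if "f \<in> topspace (M N)" for f
      using base[OF that] e_in_E by simp
    show "g (e N) = id (?v g y)" for g
      by (simp only: vy id_apply)
  qed simp
  then show ?thesis
    unfolding image_group_def gottlieb_group_def .
qed

text \<open>The start of the induction: \<open>E 0\<close> is a copy of \<open>Y\<close>, and \<open>c 0\<close> corresponds to the identity.\<close>

lemma gottlieb_group_iso_evaluation_group_0:
  assumes n: "n \<ge> 1"
  shows "gottlieb_group n Y y \<cong> evaluation_group n 0"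
    and "group (gottlieb_group n Y y)"
proof -
  let ?i = "identity_map Y"
  have i: "continuous_map Y Y ?i" "?i \<in> extensional (topspace Y)"
    by (auto simp: identity_map_def intro: continuous_map_eq[OF continuous_map_id])
  have hm: "homeomorphic_maps Y (E 0) Point the_point"
    by (rule iterated_free_loop_space_0_homeomorphic)
  then have Pt: "continuous_map Y (E 0) Point" and tp: "continuous_map (E 0) Y the_point"
    and Ptp: "\<And>x. x \<in> topspace (E 0) \<Longrightarrow> Point (the_point x) = x"
    by (auto simp: homeomorphic_maps_def)
  have \<omega>: "based_map (aut1 Y) ?i Y y (\<lambda>g. g y)"
    unfolding aut1_def
    by (rule based_map_evaluation[OF locally_compact Hausdorff y i]) (simp add: identity_map_def y)
  have gott: "gottlieb_group n Y y = image_group n (aut1 Y) ?i Y y (\<lambda>g. g y)"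
    by (simp add: image_group_def gottlieb_group_def)
  then show "group (gottlieb_group n Y y)"
    using group_image_group[OF n \<omega>] by simp
  let ?u = "\<lambda>g. \<lambda>x\<in>topspace Y. Point (g x)" and ?v = "\<lambda>g. \<lambda>x\<in>topspace Y. the_point (g x)"
  have u: "based_map (aut1 Y) ?i (M 0) (c 0) ?u"
    unfolding based_map_def aut1_def M_def
  proof (intro conjI base_in_mapping_component i)
    show "continuous_map (mapping_component Y Y ?i) (mapping_component Y (E 0) (c 0)) ?u"
      by (rule continuous_map_postcompose[OF locally_compact Hausdorff i Pt c_extensional])
        (simp add: identity_map_def c_def)
    show "?u ?i = c 0"
      unfolding c_def by (rule restrict_ext) (simp add: identity_map_def)
  qed
  have v: "based_map (M 0) (c 0) (aut1 Y) ?i ?v"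
    unfolding based_map_def
  proof (intro conjI c_in_M)
    show "continuous_map (M 0) (aut1 Y) ?v"
      unfolding M_def aut1_def
      by (rule continuous_map_postcompose[OF locally_compact Hausdorff continuous_map_c c_extensional tp i(2)])
        (simp add: identity_map_def c_def)
    show "?v (c 0) = ?i"
      unfolding identity_map_def by (rule restrict_ext) (simp add: c_def)
  qed
  show "gottlieb_group n Y y \<cong> evaluation_group n 0"
    unfolding gott
  proof (rule image_group_iso[OF n \<omega> based_map_M hm _ u v])
    show "f y = Point (?v f y)" if "f \<in> topspace (M 0)" for f
      using Ptp[OF M_apply[OF that y]] y by simp
  qed (simp_all add: y)
qed

lemma evaluation_group_Suc_iso:
  assumes n: "n \<ge> 1"
  shows "evaluation_group n N \<times>\<times> evaluation_group (Suc n) N \<cong> evaluation_group n (Suc N)"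
proof -
  let ?LM = "free_loop_space (M N) (c N)" and ?LE = "free_loop_space (E N) (e N)"
  let ?R = "image_group n ?LM (const_loop (c N)) ?LE (const_loop (e N)) (map_loop (\<lambda>f. f y))"
  note L = based_map_map_loop[OF based_map_M]
  have iso: "?R \<cong> evaluation_group n (Suc N)"
  proof (rule image_group_iso[OF n L based_map_M Loop_homeomorphic _ based_map_untranspose based_map_transpose])
    show "untranspose \<gamma> y = Loop (map_loop (\<lambda>f. f y) \<gamma>)" for \<gamma>
      using y by (simp add: untranspose_def map_loop_def)
    show "f y = Loop (map_loop (\<lambda>f. f y) (transpose f))" if f: "f \<in> topspace (M (Suc N))" for f
    proof -
      have "map_loop (\<lambda>f. f y) (transpose f) = (\<lambda>z\<in>topspace circle. the_loop (f y) z)"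
        unfolding map_loop_def by (rule restrict_ext) (use y in \<open>simp add: transpose_def\<close>)
      then show ?thesis
        by (simp only: the_loop_restrict[OF M_apply[OF f y]])
    qed
  qed simp
  have "comm_group ?R"
    by (rule comm_group.iso_imp_comm_group[OF comm_evaluation_group[OF n]
          group.iso_sym[OF group_image_group[OF n L] iso] group.is_monoid[OF group_image_group[OF n L]]])
  from image_group_free_loop_space[OF n based_map_M path_connected_M path_connected_E this] iso
  show ?thesis
    by (rule iso_trans)
qed

text \<open>A subset \<open>J\<close> of the \<open>N\<close> loop coordinates stands for the summand in which exactly the coordinates in
  \<open>J\<close> have been traded for cube coordinates.\<close>

lemma sum_gottlieb_iso_evaluation_group:
  assumes n: "n \<ge> 1"
  shows "sum_group (Pow {..<N}) (\<lambda>J. gottlieb_group (n + card J) Y y) \<cong> evaluation_group n N"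
  using n
proof (induction N arbitrary: n)
  case 0
  have "sum_group {{}} (\<lambda>J. gottlieb_group (n + card J) Y y) \<cong> gottlieb_group n Y y"
    using sum_group_singleton_iso[of "\<lambda>J. gottlieb_group (n + card J) Y y" "{}"]
      gottlieb_group_iso_evaluation_group_0(2)[OF 0] by simp
  from iso_trans[OF this gottlieb_group_iso_evaluation_group_0(1)[OF 0]]
  show ?case
    by (simp only: lessThan_0 Pow_empty)
next
  case (Suc N)
  let ?S = "\<lambda>N. sum_group (Pow {..<N}) (\<lambda>J. gottlieb_group (n + card J) Y y)"
  let ?T = "sum_group (Pow {..<N}) (\<lambda>J. gottlieb_group (Suc n + card J) Y y)"
  have G: "group (gottlieb_group (n + k) Y y)" for k
    using gottlieb_group_iso_evaluation_group_0(2)[of "n + k"] Suc.prems by simp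
  have S: "group (?S N)" and T: "group ?T"
    using G G[of "Suc _"] by (auto intro!: sum_group simp del: add_Suc add_Suc_right simp: add_Suc_shift)
  have 1: "?S N \<times>\<times> ?T \<cong> ?S (Suc N)"
    using sum_group_Pow_Suc_iso[of "\<lambda>k. gottlieb_group (n + k) Y y" N] G by (simp only: add_Suc_shift)
  have "?S N \<cong> evaluation_group n N"
    by (rule Suc.IH[OF Suc.prems])
  moreover have "?T \<cong> evaluation_group (Suc n) N"
    by (rule Suc.IH) simp
  ultimately have 2: "?S N \<times>\<times> ?T \<cong> evaluation_group n N \<times>\<times> evaluation_group (Suc n) N"
    by (rule group.DirProd_iso_trans[OF S])
  have "?S (Suc N) \<cong> ?S N \<times>\<times> ?T"
    by (rule group.iso_sym[OF DirProd_group[OF S T] 1])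
  from iso_trans[OF iso_trans[OF this 2] evaluation_group_Suc_iso[OF Suc.prems]]
  show ?case .
qed

end

section \<open>Gottlieb groups of iterated free loop spaces\<close>

theorem theorem3:
  fixes Y :: "'a topology" and y :: 'a and N n :: nat
  assumes "y \<in> topspace Y"
    and "path_connected_space Y"
    and "locally_compact_space Y"
    and "Hausdorff_space Y"
    and "well_pointed Y y"
    and "N \<ge> 1"
    and "n \<ge> 1"
  shows "gottlieb_group n (iterated_free_loop_space N Y y) (iterated_const_loop N y)
           \<cong> sum_group {0..N} (\<lambda>j. copies (N choose j) (gottlieb_group (n + j) Y y))"
proof -
  interpret connected_based_space Y y
    using assms by unfold_locales
  have G: "group (gottlieb_group (n + k) Y y)" for k
    using gottlieb_group_iso_evaluation_group_0(2)[of "n + k"] assms by simp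
  have S: "group (sum_group (Pow {..<N}) (\<lambda>J. gottlieb_group (n + card J) Y y))"
    using G by simp
  have 1: "evaluation_group n N \<cong> sum_group (Pow {..<N}) (\<lambda>J. gottlieb_group (n + card J) Y y)"
    by (rule group.iso_sym[OF S sum_gottlieb_iso_evaluation_group[OF assms(7)]])
  have 2: "gottlieb_group n (E N) (e N) \<cong> evaluation_group n N"
    by (rule group.iso_sym[OF group_image_group[OF assms(7) based_map_M] evaluation_group_iso_gottlieb_group[OF assms(7)]])
  have 3: "sum_group (Pow {..<N}) (\<lambda>J. gottlieb_group (n + card J) Y y)
      \<cong> sum_group {0..N} (\<lambda>j. copies (N choose j) (gottlieb_group (n + j) Y y))"
    by (rule sum_group_Pow_regroup_iso[of "\<lambda>k. gottlieb_group (n + k) Y y", OF G])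
  show ?thesis
    by (rule iso_trans[OF iso_trans[OF 2 1] 3])
qed

end
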